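(* Let $m\ge1$ and let $H=K_{5,\dots,5}$ be the complete $m$-partite graph with all parts of size $5$. Then for every $n$, $$b_H(n)\le\left(\frac{4}{3^{5/4}}\right)^{m-1}3^{n/4}.$$ This bound is attained if $n-5(m-1)$ is positive and divisible by $4$, namely by the graph join of $m-1$ copies of $I_5$ and $\frac{n-5(m-1)}{4}$ copies of $I_4$ (here $I_k$ is the edgeless graph on $k$ vertices, and the join of graphs is their disjoint union with all edges between different copies added).
   Context: For a graph $G$, $\mathrm{cl}(G)$ denotes its clique complex. For a finite simple graph $H$ and a fixed field $\mathbb{K}$, $b_H(n)=\max_G \sum_{i\ge -1}\dim_{\mathbb{K}}\widetilde H_i(\mathrm{cl}(G);\mathbb{K})$, where $G$ ranges over all simple graphs on at most $n$ vertices containing no induced copy of $H$ (reduced homology, the empty graph contributing $1$). "Attained" means the clique complex of the stated graph has total reduced Betti number equal to the bound. *)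

theory Defs
  imports Complex_Main "HOL-Library.Function_Algebras" "HOL-Library.Product_Lexorder"
begin

type_synonym 'a graph = "'a set \<times> 'a set set"

definition simple_graph :: "'a graph \<Rightarrow> bool" where
  "simple_graph G \<longleftrightarrow> finite (fst G) \<and> (\<forall>e\<in>snd G. e \<subseteq> fst G \<and> card e = 2)"

definition has_induced_copy :: "'a graph \<Rightarrow> 'b graph \<Rightarrow> bool" where
  "has_induced_copy G H \<longleftrightarrow>
     (\<exists>f. inj_on f (fst H) \<and> f ` fst H \<subseteq> fst G \<and>
          (\<forall>u\<in>fst H. \<forall>v\<in>fst H. u \<noteq> v \<longrightarrow>
              ({u, v} \<in> snd H \<longleftrightarrow> {f u, f v} \<in> snd G)))"

definition cl_faces :: "'a graph \<Rightarrow> 'a set set" where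
  "cl_faces G = {\<sigma>. \<sigma> \<subseteq> fst G \<and> (\<forall>u\<in>\<sigma>. \<forall>v\<in>\<sigma>. u \<noteq> v \<longrightarrow> {u, v} \<in> snd G)}"

text \<open>Faces with d elements, i.e. of dimension d-1 (d = 0 is the empty face,
  dimension -1).\<close>
definition faces_card :: "'a graph \<Rightarrow> nat \<Rightarrow> 'a set set" where
  "faces_card G d = {\<sigma>\<in>cl_faces G. card \<sigma> = d}"

definition chains :: "'a graph \<Rightarrow> nat \<Rightarrow> ('a set \<Rightarrow> 'k::field) set" where
  "chains G d = {c. \<forall>\<sigma>. c \<sigma> \<noteq> 0 \<longrightarrow> \<sigma> \<in> faces_card G d}"

definition face_sign :: "'a::linorder set \<Rightarrow> 'a \<Rightarrow> 'k::field" where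
  "face_sign \<sigma> v = (-1) ^ card {w\<in>\<sigma>. w < v}"

text \<open>Simplicial boundary map from C_{d-1} to C_{d-2} (d \<ge> 1); the map out of
  C_{-1} (d = 0) is zero. For d = 1 this is the augmentation map.\<close>
definition boundary :: "'a::linorder graph \<Rightarrow> nat \<Rightarrow> ('a set \<Rightarrow> 'k::field) \<Rightarrow> ('a set \<Rightarrow> 'k)" where
  "boundary G d c = (\<lambda>\<tau>. if d = 0 then 0 else
      (\<Sum>\<sigma>\<in>{\<sigma>\<in>faces_card G d. \<tau> \<subseteq> \<sigma> \<and> card \<sigma> = Suc (card \<tau>)}.
          face_sign \<sigma> (THE v. v \<in> \<sigma> - \<tau>) * c \<sigma>))"

abbreviation fscale :: "'k::field \<Rightarrow> ('a set \<Rightarrow> 'k) \<Rightarrow> ('a set \<Rightarrow> 'k)" where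
  "fscale a f \<equiv> (\<lambda>x. a * f x)"

text \<open>dim over 'k of the reduced homology group in dimension d-1:
  dim ker(\<partial>_{d}) - dim im(\<partial>_{d+1}).\<close>
definition red_betti :: "'k::field itself \<Rightarrow> 'a::linorder graph \<Rightarrow> nat \<Rightarrow> nat" where
  "red_betti K G d =
     vector_space.dim (fscale :: 'k \<Rightarrow> _) {c \<in> chains G d. boundary G d c = 0}
   - vector_space.dim (fscale :: 'k \<Rightarrow> _) (boundary G (Suc d) ` chains G (Suc d))"

text \<open>Total reduced Betti number: sum over dimensions i \<ge> -1 (faces have at most
  card V elements, so all homology vanishes beyond).\<close>
definition total_betti :: "'k::field itself \<Rightarrow> 'a::linorder graph \<Rightarrow> nat" where
  "total_betti K G = (\<Sum>d\<le>card (fst G). red_betti K G d)"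

text \<open>b_H(n): maximum of the total reduced Betti number over all simple graphs on at
  most n vertices with no induced copy of H. Every such graph is isomorphic to one on
  a vertex set of natural numbers, so we range over those. (The set of values is
  nonempty and finite.)\<close>
definition b_H :: "'k::field itself \<Rightarrow> 'b graph \<Rightarrow> nat \<Rightarrow> nat" where
  "b_H K H n = Max {total_betti K (G :: nat graph) | G.
      simple_graph G \<and> card (fst G) \<le> n \<and> \<not> has_induced_copy G H}"

text \<open>Complete multipartite graph with parts {i} \<times> {0..<s i} for i < k:
  vertices (i,j), two vertices adjacent iff they lie in different parts. This is
  the join of the edgeless graphs I_{s 0}, ..., I_{s (k-1)}.\<close>
definition complete_multipartite :: "nat \<Rightarrow> (nat \<Rightarrow> nat) \<Rightarrow> (nat \<times> nat) graph" where
  "complete_multipartite k s =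
     ({(i, j). i < k \<and> j < s i},
      {{x, y} | x y. x \<in> {(i, j). i < k \<and> j < s i} \<and> y \<in> {(i, j). i < k \<and> j < s i}
                    \<and> fst x \<noteq> fst y})"

definition K5m :: "nat \<Rightarrow> (nat \<times> nat) graph" where
  "K5m m = complete_multipartite m (\<lambda>_. 5)"

definition join_I5_I4 :: "nat \<Rightarrow> nat \<Rightarrow> (nat \<times> nat) graph" where
  "join_I5_I4 m q = complete_multipartite (m - 1 + q) (\<lambda>i. if i < m - 1 then 5 else 4)"

end

theory Submission
  imports Defs "HOL-Library.Nat_Bijection"
begin

text \<open>
  Writing \<open>f_d\<close> for the number of faces with \<open>d\<close> elements and \<open>r_d\<close> for the rank of the boundary map out
  of them, the reduced Betti numbers are \<open>f_d - r_d - r_{d+1}\<close>. Since boundary matrices are block triangular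
  with respect to a vertex \<open>v\<close>, ranks are superadditive, so the total Betti number \<open>b\<close> satisfies
  \<open>b G \<le> b (G - v) + b (link v)\<close>. Deleting all non-neighbours of a vertex of maximum degree one by one
  leaves a cone, whose homology vanishes, so \<open>b G\<close> is at most the sum of \<open>b\<close> over the links met on the way, and
  the bound follows by induction on the number of vertices.
  That the join attains the bound is read off its Euler characteristic, whose absolute value is a lower bound for
  the total Betti number over every field and does not depend on the order of the vertices.
\<close>

section \<open>Linear algebra\<close>

text \<open>A join with \<open>I_s\<close> adds s vertices and multiplies the total Betti number by
  s - 1, a rate of (s - 1)^(1/s) per vertex. The best size is s = 5, because 4^4 = 256 > 3^5 = 243,
  and the next best is s = 4. Forbidding H leaves room for only m - 1 factors \<open>I_5\<close>,
  and each of these beats the rate 3^(1/4) by the factor 4 / 3^(5/4): this is the constant of the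
  bound. The induction meets the same numbers. If a vertex of maximum degree D has k non-neighbours,
  then n = D + k + 1, and k links occur, each on at most D vertices because D is maximal. So the
  induction needs k \<le> 3^((k+1)/4), which fails for k = 4 alone. That case cannot be settled by
  counting and has to be turned into structure.\<close>

lemma (in vector_space) dim_mono_finite:
  assumes "S \<subseteq> T" "T \<subseteq> span B" "finite B"
  shows "dim S \<le> dim T"
proof -
  obtain A where A: "A \<subseteq> T" "independent A" "T \<subseteq> span A" "card A = dim T"
    using basis_exists by blast
  have "finite A"
    using independent_span_bound[OF assms(3) A(2)] A(1) assms(2) by blast
  then show ?thesis
    using dim_le_card[of S A] assms(1) A(3,4) by auto
qed

text \<open>A basis of the kernel extends to a basis of \<open>S\<close>, and \<open>f\<close> is
  injective on the span of the added vectors, so their images form a basis of the image. The space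
  of all functions on sets can be infinite-dimensional, and \<open>dim\<close> is 0 in the absence
  of a finite basis; finiteness therefore enters through the spanning set \<open>B\<close>.\<close>

lemma (in vector_space_pair) rank_nullity_on:
  assumes lin: "Vector_Spaces.linear s1 s2 f" and S: "vs1.subspace S" and SB: "S \<subseteq> vs1.span B" and B: "finite B"
  shows "vs1.dim S = vs2.dim (f ` S) + vs1.dim {x\<in>S. f x = 0}"
proof -
  interpret f: Vector_Spaces.linear s1 s2 f by (rule lin)
  let ?N = "{x\<in>S. f x = 0}"
  obtain A where A: "A \<subseteq> ?N" "vs1.independent A" "?N \<subseteq> vs1.span A" "card A = vs1.dim ?N"
    using vs1.basis_exists by blast
  have "A \<subseteq> S" using A(1) by blast
  obtain D where D: "A \<subseteq> D" "D \<subseteq> S" "vs1.independent D" "S \<subseteq> vs1.span D"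
    using vs1.maximal_independent_subset_extend[OF \<open>A \<subseteq> S\<close> A(2)] by blast
  have finD: "finite D"
    using vs1.independent_span_bound[OF B D(3)] D(2) SB by blast
  have finA: "finite A" using finD D(1) finite_subset by blast
  have dimS: "vs1.dim S = card D"
    using vs1.dim_unique[OF D(2) D(4) D(3)] by simp
  let ?C = "D - A"
  have zero: "f a = 0" if "a \<in> vs1.span A" for a
  proof -
    have "f a \<in> f ` vs1.span A" using that by blast
    also have "\<dots> = vs2.span (f ` A)" by (simp add: f.span_image)
    also have "\<dots> \<subseteq> vs2.span {0}" using A(1) by (intro vs2.span_mono) auto
    finally show ?thesis by simp
  qed
  have indC: "vs1.independent ?C" using D(3) vs1.dependent_mono by blast
  have disj: "x = 0" if xA: "x \<in> vs1.span A" and xC: "x \<in> vs1.span ?C" for x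
  proof -
    obtain u where u: "x = (\<Sum>a\<in>A. s1 (u a) a)"
      using xA unfolding vs1.span_finite[OF finA] by auto
    obtain w where w: "x = (\<Sum>a\<in>?C. s1 (w a) a)"
      using xC unfolding vs1.span_finite[OF finite_Diff[OF finD]] by auto
    \<comment> \<open>The two expansions of \<open>x\<close> combine into one linear relation on the
      independent set \<open>D\<close>.\<close>
    define t where "t a = (if a \<in> A then u a else - w a)" for a
    have "(\<Sum>a\<in>D. s1 (t a) a) = (\<Sum>a\<in>A. s1 (t a) a) + (\<Sum>a\<in>?C. s1 (t a) a)"
      using sum.subset_diff[OF D(1) finD, of "\<lambda>a. s1 (t a) a"] by (simp add: add.commute)
    also have "(\<Sum>a\<in>A. s1 (t a) a) = x" unfolding u t_def by (intro sum.cong) auto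
    also have "(\<Sum>a\<in>?C. s1 (t a) a) = - x"
      unfolding w t_def sum_negf[symmetric] by (intro sum.cong) auto
    finally have "(\<Sum>a\<in>D. s1 (t a) a) = 0" by simp
    then have "\<forall>a\<in>D. t a = 0" using D(3) vs1.dependent_finite[OF finD] by blast
    then have "\<forall>a\<in>A. u a = 0" using D(1) unfolding t_def by (metis subsetD)
    then show ?thesis unfolding u by (intro sum.neutral) auto
  qed
  have ker: "x = 0" if x: "x \<in> vs1.span ?C" "f x = 0" for x
  proof -
    have "vs1.span ?C \<subseteq> S" using D(2) S by (intro vs1.span_minimal) auto
    then have "x \<in> vs1.span A" using x A(3) by blast
    then show ?thesis using disj x by blast
  qed
  have inj: "inj_on f (vs1.span ?C)"
    by (simp add: f.inj_on_iff_eq_0 ker)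
  have indf: "vs2.independent (f ` ?C)"
    using f.independent_injective_image[OF indC inj] .
  have spanf: "f ` S \<subseteq> vs2.span (f ` ?C)"
  proof -
    have "f ` S \<subseteq> f ` vs1.span D" using D(4) by blast
    also have "\<dots> = vs2.span (f ` D)" by (simp add: f.span_image)
    also have "\<dots> \<subseteq> vs2.span (f ` ?C)"
    proof (rule vs2.span_minimal)
      show "f ` D \<subseteq> vs2.span (f ` ?C)"
      proof
        fix y assume "y \<in> f ` D"
        then obtain d where d: "d \<in> D" "y = f d" by blast
        show "y \<in> vs2.span (f ` ?C)"
        proof (cases "d \<in> A")
          case True
          then have "y = 0" using d A(1) by blast
          then show ?thesis by (simp add: vs2.span_zero)
        next
          case False
          then show ?thesis using d by (blast intro: vs2.span_base)
        qed
      qed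
    qed (rule vs2.subspace_span)
    finally show ?thesis .
  qed
  have "vs2.dim (f ` S) = card (f ` ?C)"
    using vs2.dim_unique[OF _ spanf indf] D(2) by blast
  also have "\<dots> = card ?C"
    by (rule card_image) (rule inj_on_subset[OF inj vs1.span_superset])
  also have "\<dots> = card D - card A" using D(1) finA by (simp add: card_Diff_subset)
  finally show ?thesis using dimS A(4) card_mono[OF finD D(1)] by simp
qed

interpretation fs: vector_space "fscale :: 'k::field \<Rightarrow> ('a set \<Rightarrow> 'k) \<Rightarrow> ('a set \<Rightarrow> 'k)"
  by unfold_locales (auto simp: fun_eq_iff algebra_simps)

interpretation fs2: vector_space_pair
    "fscale :: 'k::field \<Rightarrow> ('a set \<Rightarrow> 'k) \<Rightarrow> ('a set \<Rightarrow> 'k)"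
    "fscale :: 'k::field \<Rightarrow> ('a set \<Rightarrow> 'k) \<Rightarrow> ('a set \<Rightarrow> 'k)"
  by unfold_locales

lemma sum_fun_apply: "(\<Sum>i\<in>I. f i) x = (\<Sum>i\<in>I. f i x)"
  for f :: "'i \<Rightarrow> 'b \<Rightarrow> 'c::comm_monoid_add"
  by (induction I rule: infinite_finite_induct) auto

section \<open>Boundary maps\<close>

lemma face_subset: "\<sigma> \<in> faces_card G d \<Longrightarrow> \<sigma> \<subseteq> fst G"
  unfolding faces_card_def cl_faces_def by blast

lemma face_finite: "finite (fst G) \<Longrightarrow> \<sigma> \<in> faces_card G d \<Longrightarrow> finite \<sigma>"
  by (rule finite_subset[OF face_subset])

lemma finite_cl_faces: "finite (fst G) \<Longrightarrow> finite (cl_faces G)"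
  by (rule finite_subset[of _ "Pow (fst G)"]) (simp_all add: cl_faces_def Pow_def Collect_mono)

lemma finite_faces_card: "finite (fst G) \<Longrightarrow> finite (faces_card G d)"
  unfolding faces_card_def by (simp add: finite_cl_faces)

lemma faces_card_insertD:
  assumes "finite (fst G)" "insert w \<tau> \<in> faces_card G (Suc d)" "w \<notin> \<tau>"
  shows "\<tau> \<in> faces_card G d"
proof -
  have "finite \<tau>" using face_finite[OF assms(1,2)] by simp
  then have "card \<tau> = d" using assms(2,3) by (simp add: faces_card_def)
  then show ?thesis using assms(2) unfolding faces_card_def cl_faces_def by blast
qed

lemma faces_card_empty: "finite (fst G) \<Longrightarrow> card (fst G) < d \<Longrightarrow> faces_card G d = {}"
proof (rule ccontr)
  assume *: "finite (fst G)" "card (fst G) < d" "faces_card G d \<noteq> {}"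
  then obtain \<sigma> where \<sigma>: "\<sigma> \<in> faces_card G d" by blast
  then have "card \<sigma> \<le> card (fst G)" using card_mono[OF *(1) face_subset[OF \<sigma>]] by simp
  then show False using \<sigma> * by (simp add: faces_card_def)
qed

lemma boundary_0: "boundary G 0 c = 0"
  by (simp add: boundary_def zero_fun_def)

text \<open>The cofaces of \<open>\<tau>\<close> correspond to the vertices that can be added to it,
  which removes the definite description. The sign can be read off \<open>\<tau>\<close> alone,
  because \<open>w\<close> is not below itself.\<close>

lemma boundary_Suc:
  fixes G :: "'a::linorder graph"
  assumes fin: "finite (fst G)"
  shows "boundary G (Suc d) c \<tau> =
    (\<Sum>w\<in>{w. w \<notin> \<tau> \<and> insert w \<tau> \<in> faces_card G (Suc d)}. face_sign \<tau> w * c (insert w \<tau>))"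
proof -
  let ?A = "{w. w \<notin> \<tau> \<and> insert w \<tau> \<in> faces_card G (Suc d)}"
  let ?B = "{\<sigma>\<in>faces_card G (Suc d). \<tau> \<subseteq> \<sigma> \<and> card \<sigma> = Suc (card \<tau>)}"
  have bij: "bij_betw (\<lambda>w. insert w \<tau>) ?A ?B"
    unfolding bij_betw_def
  proof (intro conjI set_eqI iffI)
    show "inj_on (\<lambda>w. insert w \<tau>) ?A" by (auto simp: inj_on_def)
    fix \<sigma>
    show "\<sigma> \<in> ?B" if \<sigma>: "\<sigma> \<in> (\<lambda>w. insert w \<tau>) ` ?A"
    proof -
      obtain w where w: "w \<notin> \<tau>" "insert w \<tau> \<in> faces_card G (Suc d)" "\<sigma> = insert w \<tau>"
        using \<sigma> by blast
      then show ?thesis using face_finite[OF fin w(2)] by auto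
    qed
    assume \<sigma>: "\<sigma> \<in> ?B"
    then have "finite \<sigma>" using face_finite[OF fin] by blast
    then have "card (\<sigma> - \<tau>) = 1" using \<sigma> card_Diff_subset[of \<tau> \<sigma>] finite_subset[of \<tau> \<sigma>] by auto
    then obtain w where "\<sigma> - \<tau> = {w}" using card_1_singletonE by blast
    then have "\<sigma> = insert w \<tau>" "w \<notin> \<tau>" using \<sigma> by auto
    then show "\<sigma> \<in> (\<lambda>w. insert w \<tau>) ` ?A" using \<sigma> by blast
  qed
  have "boundary G (Suc d) c \<tau> = (\<Sum>w\<in>?A. face_sign (insert w \<tau>) (THE v. v \<in> insert w \<tau> - \<tau>) * c (insert w \<tau>))"
    unfolding boundary_def by (subst sum.reindex_bij_betw[OF bij, symmetric]) simp
  also have "\<dots> = (\<Sum>w\<in>?A. face_sign \<tau> w * c (insert w \<tau>))"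
  proof (intro sum.cong refl)
    fix w assume w: "w \<in> ?A"
    then have "(THE v. v \<in> insert w \<tau> - \<tau>) = w" by auto
    moreover have "{u \<in> insert w \<tau>. u < w} = {u \<in> \<tau>. u < w}" by auto
    ultimately show "face_sign (insert w \<tau>) (THE v. v \<in> insert w \<tau> - \<tau>) * c (insert w \<tau>)
        = face_sign \<tau> w * c (insert w \<tau>)" by (simp add: face_sign_def)
  qed
  finally show ?thesis .
qed

lemma linear_boundary:
  fixes G :: "'a::linorder graph"
  assumes "finite (fst G)"
  shows "Vector_Spaces.linear (fscale :: 'k::field \<Rightarrow> _) fscale (boundary G d)"
proof (cases d)
  case 0
  then show ?thesis
    by unfold_locales (auto simp: boundary_0 fun_eq_iff)
next
  case (Suc e)
  show ?thesis unfolding Suc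
    by unfold_locales
      (simp_all add: fun_eq_iff boundary_Suc[OF assms] sum.distrib sum_distrib_left distrib_left mult.left_commute)
qed

lemma boundary_Suc_in_chains:
  assumes "finite (fst G)"
  shows "boundary G (Suc d) c \<in> chains G d"
  unfolding chains_def
proof (intro CollectI allI impI)
  fix \<tau> assume "boundary G (Suc d) c \<tau> \<noteq> 0"
  then obtain w where "w \<notin> \<tau>" "insert w \<tau> \<in> faces_card G (Suc d)"
    unfolding boundary_Suc[OF assms] by (metis (mono_tags, lifting) mem_Collect_eq sum.neutral)
  then show "\<tau> \<in> faces_card G d" using faces_card_insertD[OF assms] by blast
qed

lemma face_sign_insert:
  assumes "finite \<tau>" "w \<notin> \<tau>"
  shows "face_sign (insert w \<tau>) v = (if w < v then - face_sign \<tau> v else face_sign \<tau> v)"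
proof -
  have "{u \<in> insert w \<tau>. u < v} = (if w < v then insert w {u \<in> \<tau>. u < v} else {u \<in> \<tau>. u < v})" by auto
  then show ?thesis using assms by (simp add: face_sign_def)
qed

text \<open>Two vertices \<open>w\<close> < \<open>u\<close> can be added to \<open>\<tau>\<close>
  in either order. Adding \<open>w\<close> first flips the sign of \<open>u\<close>, whereas adding
  \<open>u\<close> first leaves the sign of \<open>w\<close> as it was, so the two terms
  cancel.\<close>

lemma boundary_boundary:
  fixes G :: "'a::linorder graph" and c :: "'a set \<Rightarrow> 'k::field"
  assumes fin: "finite (fst G)"
  shows "boundary G d (boundary G (Suc d) c) = 0"
proof (cases d)
  case 0
  then show ?thesis by (simp add: boundary_0)
next
  case (Suc e)
  show ?thesis unfolding Suc
  proof
    fix \<tau> :: "'a set"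
    let ?A = "{w. w \<notin> \<tau> \<and> insert w \<tau> \<in> faces_card G (Suc e)}"
    let ?A2 = "\<lambda>w. {u. u \<notin> insert w \<tau> \<and> insert u (insert w \<tau>) \<in> faces_card G (Suc (Suc e))}"
    define h where "h = (\<lambda>(w, u). face_sign \<tau> w * (face_sign (insert w \<tau>) u * c (insert u (insert w \<tau>))))"
    \<comment> \<open>One ordered pair for each unordered pair of added vertices; its mirror image
      \<open>prod.swap\<close> supplies the other order.\<close>
    define P where "P = {(w, u). w \<notin> \<tau> \<and> u \<notin> \<tau> \<and> w < u \<and> insert u (insert w \<tau>) \<in> faces_card G (Suc (Suc e))}"
    have faceV: "w \<in> fst G \<and> u \<in> fst G \<and> finite \<tau>"
      if "insert u (insert w \<tau>) \<in> faces_card G (Suc (Suc e))" for u w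
      using face_subset[OF that] face_finite[OF fin that] by simp
    have finP: "finite P"
      by (rule finite_subset[of _ "fst G \<times> fst G"]) (use fin faceV in \<open>auto simp: P_def\<close>)
    have finA: "finite ?A"
      by (rule finite_subset[OF _ fin]) (use face_subset in blast)
    have finA2: "finite (?A2 w)" for w
      by (rule finite_subset[OF _ fin]) (use face_subset in blast)
    have Sig: "Sigma ?A ?A2 = P \<union> prod.swap ` P"
    proof (intro set_eqI iffI)
      fix x assume x: "x \<in> Sigma ?A ?A2"
      obtain w u where xw: "x = (w, u)" by force
      from x xw have "w < u \<or> u < w" by auto
      then have "(w, u) \<in> P \<or> (u, w) \<in> P"
        using x xw insert_commute[of u w \<tau>] by (auto simp: P_def)
      then show "x \<in> P \<union> prod.swap ` P"
        unfolding xw by force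
    next
      fix x assume x: "x \<in> P \<union> prod.swap ` P"
      obtain w u where xw: "x = (w, u)" by force
      have wu: "w \<notin> \<tau>" "u \<notin> insert w \<tau>" "insert u (insert w \<tau>) \<in> faces_card G (Suc (Suc e))"
        using x xw insert_commute[of u w \<tau>] by (auto simp: P_def)
      then show "x \<in> Sigma ?A ?A2"
        using faces_card_insertD[OF fin wu(3,2)] xw by simp
    qed
    have "boundary G (Suc e) (boundary G (Suc (Suc e)) c) \<tau>
        = (\<Sum>w\<in>?A. \<Sum>u\<in>?A2 w. h (w, u))"
      by (simp add: boundary_Suc[OF fin] h_def sum_distrib_left)
    also have "\<dots> = (\<Sum>x\<in>Sigma ?A ?A2. h x)"
      by (subst sum.Sigma) (use finA finA2 in \<open>auto simp: case_prod_beta\<close>)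
    also have "\<dots> = (\<Sum>x\<in>P. h x) + (\<Sum>x\<in>prod.swap ` P. h x)"
      unfolding Sig by (rule sum.union_disjoint) (use finP in \<open>auto simp: P_def\<close>)
    also have "(\<Sum>x\<in>prod.swap ` P. h x) = (\<Sum>x\<in>P. h (prod.swap x))"
      by (subst sum.reindex) auto
    also have "(\<Sum>x\<in>P. h x) + (\<Sum>x\<in>P. h (prod.swap x)) = (\<Sum>x\<in>P. h x + h (prod.swap x))"
      by (simp add: sum.distrib)
    also have "\<dots> = 0"
    proof (intro sum.neutral ballI)
      fix x assume x: "x \<in> P"
      obtain w u where [simp]: "x = (w, u)" by force
      have "finite \<tau>" "w \<notin> \<tau>" "u \<notin> \<tau>" "w < u" using x faceV by (auto simp: P_def)
      then show "h x + h (prod.swap x) = 0"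
        by (auto simp: h_def face_sign_insert insert_commute[of u w])
    qed
    finally show "boundary G (Suc e) (boundary G (Suc (Suc e)) c) \<tau> = (0 :: 'a set \<Rightarrow> 'k) \<tau>" by simp
  qed
qed

section \<open>Betti numbers in terms of ranks\<close>

lemma subspace_chains: "fs.subspace (chains G d)"
  unfolding fs.subspace_def chains_def
proof (intro conjI ballI allI CollectI impI, goal_cases)
  case (2 x y \<sigma>)
  then have "x \<sigma> \<noteq> 0 \<or> y \<sigma> \<noteq> 0" by auto
  then show ?case using 2 by blast
qed auto

definition basis_chain :: "'a set \<Rightarrow> 'a set \<Rightarrow> 'k::field" where
  "basis_chain \<sigma> = (\<lambda>\<rho>. if \<rho> = \<sigma> then 1 else 0)"

lemma basis_chain_combination:
  assumes "finite F"
  shows "(\<Sum>\<sigma>\<in>F. fscale (u \<sigma>) (basis_chain \<sigma>)) = (\<lambda>\<rho>. if \<rho> \<in> F then u \<rho> else 0)"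
proof
  fix \<rho>
  have "(\<Sum>\<sigma>\<in>F. fscale (u \<sigma>) (basis_chain \<sigma>)) \<rho> = (\<Sum>\<sigma>\<in>F. if \<rho> = \<sigma> then u \<sigma> else 0)"
    unfolding sum_fun_apply by (intro sum.cong) (auto simp: basis_chain_def)
  then show "(\<Sum>\<sigma>\<in>F. fscale (u \<sigma>) (basis_chain \<sigma>)) \<rho> = (if \<rho> \<in> F then u \<rho> else 0)"
    using assms by simp
qed

lemma inj_basis_chain: "inj_on (basis_chain :: 'a set \<Rightarrow> 'a set \<Rightarrow> 'k::field) F"
proof (rule inj_onI)
  fix \<sigma> \<rho> :: "'a set" assume "(basis_chain \<sigma> :: _ \<Rightarrow> 'k) = basis_chain \<rho>"
  then have "(basis_chain \<sigma> \<sigma> :: 'k) = basis_chain \<rho> \<sigma>" by simp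
  then show "\<sigma> = \<rho>" by (simp add: basis_chain_def split: if_splits)
qed

lemma chains_span:
  fixes G :: "'a graph"
  assumes "finite (fst G)"
  shows "(chains G d :: ('a set \<Rightarrow> 'k::field) set) \<subseteq> fs.span (basis_chain ` faces_card G d)"
proof
  fix c :: "'a set \<Rightarrow> 'k" assume c: "c \<in> chains G d"
  have "c = (\<Sum>\<sigma>\<in>faces_card G d. fscale (c \<sigma>) (basis_chain \<sigma>))"
    unfolding basis_chain_combination[OF finite_faces_card[OF assms]]
    using c by (auto simp: chains_def fun_eq_iff)
  also have "\<dots> \<in> fs.span (basis_chain ` faces_card G d)"
    by (intro fs.span_sum fs.span_scale fs.span_base) auto
  finally show "c \<in> fs.span (basis_chain ` faces_card G d)" .
qed

lemma dim_chains:
  fixes G :: "'a graph"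
  assumes "finite (fst G)"
  shows "fs.dim (chains G d :: ('a set \<Rightarrow> 'k::field) set) = card (faces_card G d)"
proof -
  let ?F = "faces_card G d"
  let ?B = "(basis_chain :: 'a set \<Rightarrow> 'a set \<Rightarrow> 'k) ` ?F"
  note fin = finite_faces_card[OF assms, of d]
  have "fs.independent ?B"
  proof
    assume "fs.dependent ?B"
    then obtain u :: "('a set \<Rightarrow> 'k) \<Rightarrow> 'k" and b where
      b: "b \<in> ?B" "u b \<noteq> 0" and sum0: "(\<Sum>b\<in>?B. fscale (u b) b) = 0"
      using fs.dependent_finite fin by blast
    have "(\<Sum>b\<in>?B. fscale (u b) b) =
        (\<Sum>\<sigma>\<in>?F. fscale (u (basis_chain \<sigma>)) (basis_chain \<sigma>))"
      by (subst sum.reindex[OF inj_basis_chain]) simp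
    also have "\<dots> = (\<lambda>\<rho>. if \<rho> \<in> ?F then u (basis_chain \<rho>) else 0)"
      by (rule basis_chain_combination[OF fin])
    finally have "(\<lambda>\<rho>. if \<rho> \<in> ?F then u (basis_chain \<rho>) else 0) = 0"
      using sum0 by simp
    then have "(if \<rho> \<in> ?F then u (basis_chain \<rho>) else 0) = 0" for \<rho>
      by (auto dest: fun_cong[of _ _ \<rho>])
    then have "\<forall>\<rho>\<in>?F. u (basis_chain \<rho>) = 0" by meson
    then show False using b by auto
  qed
  moreover have "?B \<subseteq> chains G d" by (auto simp: chains_def basis_chain_def split: if_splits)
  ultimately have "fs.dim (chains G d :: ('a set \<Rightarrow> 'k) set) = card ?B"
    using fs.dim_unique[OF _ chains_span[OF assms]] by blast
  then show ?thesis by (simp add: card_image[OF inj_basis_chain])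
qed

definition boundary_rank :: "'k::field itself \<Rightarrow> 'a::linorder graph \<Rightarrow> nat \<Rightarrow> nat" where
  "boundary_rank K G d = fs.dim ((boundary G d :: ('a set \<Rightarrow> 'k) \<Rightarrow> _) ` chains G d)"

lemma fs_dim_mono:
  fixes G :: "'a graph" and S :: "('a set \<Rightarrow> 'k::field) set"
  assumes "finite (fst G)" "S \<subseteq> T" "T \<subseteq> chains G d"
  shows "fs.dim S \<le> fs.dim T"
  by (rule fs.dim_mono_finite[OF assms(2) order_trans[OF assms(3) chains_span[OF assms(1)]]])
    (use assms(1) in \<open>simp add: finite_faces_card\<close>)

lemma fs_rank_nullity:
  fixes G :: "'a graph" and S :: "('a set \<Rightarrow> 'k::field) set" and f :: "('a set \<Rightarrow> 'k) \<Rightarrow> ('a set \<Rightarrow> 'k)"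
  assumes "finite (fst G)" "Vector_Spaces.linear fscale fscale f" "fs.subspace S" "S \<subseteq> chains G d"
  shows "fs.dim S = fs.dim (f ` S) + fs.dim {x\<in>S. f x = 0}"
  by (rule fs2.rank_nullity_on[OF assms(2,3) order_trans[OF assms(4) chains_span[OF assms(1)]]])
    (use assms(1) in \<open>simp add: finite_faces_card\<close>)

lemma boundary_rank_0:
  fixes K :: "'k::field itself" and G :: "'a::linorder graph"
  shows "boundary_rank K G 0 = 0"
proof -
  have "fs.dim ((boundary G 0 :: ('a set \<Rightarrow> 'k) \<Rightarrow> _) ` chains G 0) \<le> card ({} :: ('a set \<Rightarrow> 'k) set)"
    by (rule fs.dim_le_card) (auto simp: boundary_0)
  then show ?thesis by (simp add: boundary_rank_def)
qed

text \<open>This is rank-nullity on the chain space. The subtraction in \<open>red_betti\<close>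
  does not truncate, since every boundary is a cycle. Stating it over \<open>int\<close> reduces all
  later comparisons to linear arithmetic.\<close>

lemma red_betti_eq:
  fixes K :: "'k::field itself" and G :: "'a::linorder graph"
  assumes "finite (fst G)"
  shows "int (red_betti K G d) =
    int (card (faces_card G d)) - int (boundary_rank K G d) - int (boundary_rank K G (Suc d))"
proof -
  let ?Z = "{c \<in> chains G d. boundary G d c = (0 :: 'a set \<Rightarrow> 'k)}"
  have "card (faces_card G d) = boundary_rank K G d + fs.dim ?Z"
    using fs_rank_nullity[OF assms linear_boundary[OF assms, where 'k='k] subspace_chains order_refl]
    unfolding boundary_rank_def dim_chains[OF assms] by blast
  moreover have "boundary_rank K G (Suc d) \<le> fs.dim ?Z"
    unfolding boundary_rank_def
    by (rule fs_dim_mono[OF assms])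
      (auto simp: boundary_Suc_in_chains[OF assms] boundary_boundary[OF assms])
  ultimately show ?thesis
    by (simp add: red_betti_def boundary_rank_def)
qed

section \<open>Links and deletions\<close>

definition induced :: "'a graph \<Rightarrow> 'a set \<Rightarrow> 'a graph" where
  "induced G S = (S, {e \<in> snd G. e \<subseteq> S})"

definition nbhd :: "'a graph \<Rightarrow> 'a \<Rightarrow> 'a set" where
  "nbhd G v = {w \<in> fst G. w \<noteq> v \<and> {v, w} \<in> snd G}"

lemma fst_induced [simp]: "fst (induced G S) = S"
  by (simp add: induced_def)

lemma induced_edge_iff: "{u, v} \<in> snd (induced G S) \<longleftrightarrow> {u, v} \<in> snd G \<and> u \<in> S \<and> v \<in> S"
  by (auto simp: induced_def)

lemma cl_faces_induced: "S \<subseteq> fst G \<Longrightarrow> cl_faces (induced G S) = {\<sigma> \<in> cl_faces G. \<sigma> \<subseteq> S}"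
  unfolding cl_faces_def induced_edge_iff fst_induced by blast

lemma induced_induced: "T \<subseteq> S \<Longrightarrow> induced (induced G S) T = induced G T"
  unfolding induced_def by auto

lemma faces_card_delete:
  "\<sigma> \<in> faces_card (induced G (fst G - {v})) d \<longleftrightarrow> \<sigma> \<in> faces_card G d \<and> v \<notin> \<sigma>"
proof -
  have "\<sigma> \<in> cl_faces G \<Longrightarrow> \<sigma> \<subseteq> fst G - {v} \<longleftrightarrow> v \<notin> \<sigma>" by (auto simp: cl_faces_def)
  then show ?thesis unfolding faces_card_def by (auto simp: cl_faces_induced)
qed

lemma faces_card_link:
  assumes fin: "finite (fst G)" and v: "v \<in> fst G"
  shows "\<tau> \<in> faces_card (induced G (nbhd G v)) d \<longleftrightarrow> v \<notin> \<tau> \<and> insert v \<tau> \<in> faces_card G (Suc d)"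
proof -
  have sub: "nbhd G v \<subseteq> fst G" by (auto simp: nbhd_def)
  have 1: "\<tau> \<in> cl_faces (induced G (nbhd G v)) \<longleftrightarrow> v \<notin> \<tau> \<and> insert v \<tau> \<in> cl_faces G"
  proof
    assume a: "\<tau> \<in> cl_faces (induced G (nbhd G v))"
    then have "\<tau> \<in> cl_faces G" "\<tau> \<subseteq> nbhd G v" by (auto simp: cl_faces_induced[OF sub])
    moreover have "{w, v} \<in> snd G" if "w \<in> \<tau>" for w
      using that \<open>\<tau> \<subseteq> nbhd G v\<close> by (auto simp: nbhd_def insert_commute)
    ultimately show "v \<notin> \<tau> \<and> insert v \<tau> \<in> cl_faces G"
      using v by (auto simp: cl_faces_def nbhd_def)
  next
    assume a: "v \<notin> \<tau> \<and> insert v \<tau> \<in> cl_faces G"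
    then have "\<tau> \<in> cl_faces G" unfolding cl_faces_def by blast
    moreover have "w \<in> nbhd G v" if "w \<in> \<tau>" for w
    proof -
      have "w \<noteq> v" "w \<in> fst G" "{v, w} \<in> snd G" using a that unfolding cl_faces_def by auto
      then show ?thesis by (simp add: nbhd_def)
    qed
    ultimately have "\<tau> \<in> cl_faces G" "\<tau> \<subseteq> nbhd G v" by blast+
    then show "\<tau> \<in> cl_faces (induced G (nbhd G v))" by (simp add: cl_faces_induced[OF sub])
  qed
  show ?thesis
  proof (cases "v \<notin> \<tau> \<and> insert v \<tau> \<in> cl_faces G")
    case True
    then have "finite (insert v \<tau>)" using finite_subset[OF _ fin] unfolding cl_faces_def by blast
    then show ?thesis using True by (simp add: faces_card_def 1)
  qed (auto simp: faces_card_def 1)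
qed

text \<open>Faces avoiding \<open>v\<close> are the faces of the deletion; taking \<open>v\<close>
  out of the others gives the faces of the link, with one element fewer.\<close>

lemma card_faces_delete_link:
  assumes fin: "finite (fst G)" and v: "v \<in> fst G"
  shows "card (faces_card G (Suc d)) =
    card (faces_card (induced G (fst G - {v})) (Suc d)) + card (faces_card (induced G (nbhd G v)) d)"
proof -
  let ?D = "faces_card (induced G (fst G - {v})) (Suc d)" and ?L = "faces_card (induced G (nbhd G v)) d"
  have "faces_card G (Suc d) = ?D \<union> insert v ` ?L"
  proof (intro set_eqI iffI)
    fix \<sigma> assume \<sigma>: "\<sigma> \<in> faces_card G (Suc d)"
    show "\<sigma> \<in> ?D \<union> insert v ` ?L"
    proof (cases "v \<in> \<sigma>")
      case True
      then have "\<sigma> = insert v (\<sigma> - {v})" by blast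
      moreover from this have "\<sigma> - {v} \<in> ?L" using \<sigma> faces_card_link[OF fin v] by force
      ultimately show ?thesis by blast
    qed (use \<sigma> faces_card_delete[of \<sigma> G v] in auto)
  qed (auto simp: faces_card_delete faces_card_link[OF fin v])
  moreover have "?D \<inter> insert v ` ?L = {}" by (auto simp: faces_card_delete)
  moreover have "inj_on (insert v) ?L"
    by (rule inj_onI) (metis faces_card_link[OF fin v] insert_ident)
  moreover have "finite ?D" "finite ?L"
    using fin by (auto intro!: finite_faces_card simp: nbhd_def)
  ultimately show ?thesis by (simp add: card_Un_disjoint card_image)
qed

lemma card_faces_0:
  fixes G :: "'a graph"
  assumes "finite (fst G)"
  shows "card (faces_card G 0) = 1"
proof -
  have "faces_card G 0 = {{}}"
  proof (intro set_eqI iffI)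
    fix \<sigma> assume \<sigma>: "\<sigma> \<in> faces_card G 0"
    then have "card \<sigma> = 0" by (simp add: faces_card_def)
    then show "\<sigma> \<in> {{}}" using face_finite[OF assms \<sigma>] by simp
  next
    fix \<sigma> :: "'a set" assume "\<sigma> \<in> {{}}"
    then show "\<sigma> \<in> faces_card G 0" unfolding faces_card_def cl_faces_def by simp
  qed
  then show ?thesis by simp
qed

section \<open>The projection of chains onto the link of a vertex\<close>

definition link_sign :: "'a::linorder \<Rightarrow> 'a set \<Rightarrow> 'k::field" where
  "link_sign v \<tau> = (-1) ^ card {w \<in> \<tau>. v < w}"

definition link_map :: "'a::linorder \<Rightarrow> ('a set \<Rightarrow> 'k::field) \<Rightarrow> ('a set \<Rightarrow> 'k)" where
  "link_map v c = (\<lambda>\<tau>. if v \<in> \<tau> then 0 else link_sign v \<tau> * c (insert v \<tau>))"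

lemma linear_link_map:
  "Vector_Spaces.linear (fscale :: 'k::field \<Rightarrow> _) fscale (link_map (v :: 'a::linorder))"
  by unfold_locales (auto simp: fun_eq_iff link_map_def algebra_simps)

lemma link_sign_square: "link_sign v \<tau> * (link_sign v \<tau> * x) = (x :: 'k::field)"
  unfolding link_sign_def mult.assoc[symmetric] power_mult_distrib[symmetric] by simp

lemma link_sign_insert:
  assumes "finite \<tau>" "w \<notin> \<tau>"
  shows "link_sign v (insert w \<tau>) = (if v < w then - link_sign v \<tau> else (link_sign v \<tau> :: 'k::field))"
proof -
  have "{u \<in> insert w \<tau>. v < u} = (if v < w then insert w {u \<in> \<tau>. v < u} else {u \<in> \<tau>. v < u})" by auto
  then show ?thesis using assms by (simp add: link_sign_def)
qed

text \<open>Adding \<open>w\<close> > \<open>v\<close> changes both \<open>link_sign v\<close> and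
  the effect of \<open>v\<close> on the sign of \<open>w\<close>, and the two changes cancel. This
  is why \<open>link_sign\<close> counts the elements above \<open>v\<close>: with those below
  \<open>v\<close>, as in \<open>face_sign\<close>, the two maps would commute only up to the sign
  -1.\<close>

lemma link_map_boundary:
  fixes G :: "'a::linorder graph" and c :: "'a set \<Rightarrow> 'k::field"
  assumes fin: "finite (fst G)" and v: "v \<in> fst G"
  shows "link_map v (boundary G (Suc (Suc d)) c) = boundary (induced G (nbhd G v)) (Suc d) (link_map v c)"
proof
  fix \<tau> :: "'a set"
  let ?L = "induced G (nbhd G v)"
  have finL: "finite (fst ?L)" using fin by (simp add: nbhd_def)
  let ?A = "{w. w \<notin> \<tau> \<and> insert w \<tau> \<in> faces_card ?L (Suc d)}"
  show "link_map v (boundary G (Suc (Suc d)) c) \<tau> = boundary ?L (Suc d) (link_map v c) \<tau>"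
  proof (cases "v \<in> \<tau>")
    case True
    then have "?A = {}" using faces_card_link[OF fin v] by blast
    then show ?thesis unfolding boundary_Suc[OF finL] by (simp only: sum.empty) (simp add: link_map_def True)
  next
    case False
    have A: "?A = {w. w \<notin> insert v \<tau> \<and> insert w (insert v \<tau>) \<in> faces_card G (Suc (Suc d))}"
      using False by (auto simp: faces_card_link[OF fin v] insert_commute[of v])
    have "link_map v (boundary G (Suc (Suc d)) c) \<tau> =
        (\<Sum>w\<in>?A. link_sign v \<tau> * (face_sign (insert v \<tau>) w * c (insert w (insert v \<tau>))))"
      unfolding A by (simp add: link_map_def False boundary_Suc[OF fin] sum_distrib_left)
    also have "\<dots> = (\<Sum>w\<in>?A. face_sign \<tau> w * link_map v c (insert w \<tau>))"
    proof (intro sum.cong refl)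
      fix w assume w: "w \<in> ?A"
      then have "v \<notin> insert w \<tau>" "w \<notin> \<tau>" using faces_card_link[OF fin v] by blast+
      moreover have "finite \<tau>" using w face_finite[OF finL, of "insert w \<tau>" "Suc d"] by simp
      ultimately show "link_sign v \<tau> * (face_sign (insert v \<tau>) w * c (insert w (insert v \<tau>)))
          = face_sign \<tau> w * link_map v c (insert w \<tau>)"
        by (simp add: link_map_def link_sign_insert face_sign_insert insert_commute[of v w])
    qed
    also have "\<dots> = boundary ?L (Suc d) (link_map v c) \<tau>" by (simp add: boundary_Suc[OF finL])
    finally show ?thesis .
  qed
qed

lemma link_map_chains:
  fixes G :: "'a::linorder graph"
  assumes fin: "finite (fst G)" and v: "v \<in> fst G"
  shows "link_map v ` (chains G (Suc d) :: ('a set \<Rightarrow> 'k::field) set) = chains (induced G (nbhd G v)) d"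
proof (intro set_eqI iffI)
  fix e :: "'a set \<Rightarrow> 'k" assume "e \<in> link_map v ` chains G (Suc d)"
  then show "e \<in> chains (induced G (nbhd G v)) d"
    by (auto simp: chains_def link_map_def faces_card_link[OF fin v] split: if_splits)
next
  fix e :: "'a set \<Rightarrow> 'k" assume e: "e \<in> chains (induced G (nbhd G v)) d"
  define c where "c = (\<lambda>\<sigma>. if v \<in> \<sigma> then link_sign v (\<sigma> - {v}) * e (\<sigma> - {v}) else 0)"
  have "c \<in> chains G (Suc d)"
    unfolding chains_def
  proof (intro CollectI allI impI)
    fix \<sigma> assume "c \<sigma> \<noteq> 0"
    then have "v \<in> \<sigma>" "e (\<sigma> - {v}) \<noteq> 0" by (auto simp: c_def split: if_splits)
    then have "insert v (\<sigma> - {v}) \<in> faces_card G (Suc d)"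
      using e faces_card_link[OF fin v] unfolding chains_def by blast
    then show "\<sigma> \<in> faces_card G (Suc d)" using \<open>v \<in> \<sigma>\<close> by (simp add: insert_absorb)
  qed
  moreover have "link_map v c = e"
  proof
    fix \<tau>
    show "link_map v c \<tau> = e \<tau>"
    proof (cases "v \<in> \<tau>")
      case True
      then have "\<tau> \<notin> faces_card (induced G (nbhd G v)) d" using faces_card_link[OF fin v] by blast
      then have "e \<tau> = 0" using e by (auto simp: chains_def)
      then show ?thesis using True by (simp add: link_map_def)
    next
      case False
      then show ?thesis by (simp add: link_map_def c_def link_sign_square)
    qed
  qed
  ultimately show "e \<in> link_map v ` chains G (Suc d)" by blast
qed

lemma delete_chains:
  "c \<in> chains (induced G (fst G - {v})) d \<longleftrightarrow> c \<in> chains G d \<and> (\<forall>\<sigma>. v \<in> \<sigma> \<longrightarrow> c \<sigma> = 0)"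
  unfolding chains_def by (auto simp: faces_card_delete)

text \<open>The additional cofaces in \<open>G\<close> contain \<open>v\<close>, and there
  \<open>c\<close> vanishes.\<close>

lemma boundary_delete:
  fixes G :: "'a::linorder graph"
  assumes fin: "finite (fst G)" and c: "c \<in> chains (induced G (fst G - {v})) d"
  shows "boundary (induced G (fst G - {v})) d c = boundary G d c"
proof (cases d)
  case 0
  then show ?thesis by (simp add: boundary_0)
next
  case (Suc e)
  have finD: "finite (fst (induced G (fst G - {v})))" using fin by simp
  show ?thesis unfolding Suc
  proof
    fix \<tau>
    have "finite {w. w \<notin> \<tau> \<and> insert w \<tau> \<in> faces_card G (Suc e)}"
      by (rule finite_subset[OF _ fin]) (use face_subset in blast)
    then show "boundary (induced G (fst G - {v})) (Suc e) c \<tau> = boundary G (Suc e) c \<tau>"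
      unfolding boundary_Suc[OF fin] boundary_Suc[OF finD]
      by (rule sum.mono_neutral_left) (use c in \<open>auto simp: faces_card_delete delete_chains Suc\<close>)
  qed
qed

lemma boundary_rank_delete:
  fixes K :: "'k::field itself" and G :: "'a::linorder graph"
  assumes fin: "finite (fst G)"
  shows "boundary_rank K (induced G (fst G - {v})) d \<le> boundary_rank K G d"
proof (cases d)
  case 0
  then show ?thesis by (simp add: boundary_rank_0)
next
  case (Suc e)
  have "boundary (induced G (fst G - {v})) d ` chains (induced G (fst G - {v})) d
      \<subseteq> (boundary G d :: ('a set \<Rightarrow> 'k) \<Rightarrow> _) ` chains G d"
  proof
    fix b :: "'a set \<Rightarrow> 'k" assume "b \<in> boundary (induced G (fst G - {v})) d ` chains (induced G (fst G - {v})) d"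
    then obtain c where c: "c \<in> chains (induced G (fst G - {v})) d" "b = boundary (induced G (fst G - {v})) d c"
      by blast
    then have "b = boundary G d c" using boundary_delete[OF fin c(1)] by simp
    moreover have "c \<in> chains G d" using c(1) unfolding delete_chains by (rule conjunct1)
    ultimately show "b \<in> boundary G d ` chains G d" by (rule image_eqI)
  qed
  then show ?thesis
    unfolding boundary_rank_def
    by (rule fs_dim_mono[OF fin, of _ _ e]) (auto simp: Suc boundary_Suc_in_chains[OF fin])
qed

text \<open>In the splitting of the chains of \<open>G\<close> into those avoiding \<open>v\<close> and those containing \<open>v\<close>, the boundary
  is block triangular, and its diagonal blocks are the boundaries of the deletion and of the link.\<close>

lemma boundary_rank_delete_link:
  fixes K :: "'k::field itself" and G :: "'a::linorder graph"
  assumes fin: "finite (fst G)" and v: "v \<in> fst G"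
  shows "boundary_rank K (induced G (fst G - {v})) (Suc d) + boundary_rank K (induced G (nbhd G v)) d
    \<le> boundary_rank K G (Suc d)"
proof (cases d)
  case 0
  then show ?thesis using boundary_rank_delete[OF fin] by (simp add: boundary_rank_0)
next
  case (Suc e)
  let ?D = "induced G (fst G - {v})" and ?L = "induced G (nbhd G v)"
  let ?W = "(boundary G (Suc d) :: ('a set \<Rightarrow> 'k) \<Rightarrow> _) ` chains G (Suc d)"
  have WC: "?W \<subseteq> chains G d" by (auto simp: boundary_Suc_in_chains[OF fin])
  have W: "fs.subspace ?W"
    using fs2.linear_subspace_image[OF linear_boundary[OF fin] subspace_chains] .
  \<comment> \<open>Rank-nullity for \<open>link_map v\<close> on the space \<open>?W\<close> of
    boundaries: the image accounts for the rank of the link, and the kernel contains the boundaries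
    of the deletion.\<close>
  have "link_map v ` ?W = boundary ?L (Suc e) ` link_map v ` chains G (Suc d)"
    unfolding Suc image_image by (simp add: link_map_boundary[OF fin v])
  also have "\<dots> = boundary ?L d ` chains ?L d"
    unfolding link_map_chains[OF fin v] Suc ..
  finally have img: "link_map v ` ?W = boundary ?L d ` chains ?L d" .
  \<comment> \<open>The inclusion can be strict: coning a cycle of the link with \<open>v\<close>
    makes it a boundary in \<open>G\<close>, though it need not be one in the deletion. Hence ranks
    are superadditive but not additive.\<close>
  have ker: "boundary ?D (Suc d) ` chains ?D (Suc d) \<subseteq> {x \<in> ?W. link_map v x = 0}"
  proof
    fix b :: "'a set \<Rightarrow> 'k" assume "b \<in> boundary ?D (Suc d) ` chains ?D (Suc d)"
    then obtain c where c: "c \<in> chains ?D (Suc d)" "b = boundary ?D (Suc d) c" by blast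
    have "b = boundary G (Suc d) c" using boundary_delete[OF fin c(1)] c(2) by simp
    moreover have "c \<in> chains G (Suc d)" using c(1) unfolding delete_chains by (rule conjunct1)
    ultimately have "b \<in> ?W" by (rule image_eqI)
    moreover have "b \<in> chains ?D d" unfolding c(2) by (rule boundary_Suc_in_chains) (use fin in simp)
    then have "link_map v b = 0" unfolding delete_chains by (auto simp: link_map_def fun_eq_iff)
    ultimately show "b \<in> {x \<in> ?W. link_map v x = 0}" by blast
  qed
  have "fs.dim (boundary ?D (Suc d) ` (chains ?D (Suc d) :: ('a set \<Rightarrow> 'k) set)) \<le> fs.dim {x \<in> ?W. link_map v x = 0}"
    by (rule fs_dim_mono[OF fin ker, of d]) (use WC in blast)
  then show ?thesis
    using fs_rank_nullity[OF fin linear_link_map W WC, of v] unfolding img boundary_rank_def by simp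
qed

text \<open>Any chain \<open>e\<close> of the deletion is the part avoiding \<open>v\<close> of the
  boundary of the cone over \<open>e\<close> with apex \<open>v\<close>. So the boundaries project
  onto all chains of the deletion, and the rank is at least their dimension.\<close>

lemma boundary_rank_cone:
  fixes K :: "'k::field itself" and G :: "'a::linorder graph"
  assumes fin: "finite (fst G)" and v: "v \<in> fst G" and cone: "nbhd G v = fst G - {v}"
  shows "card (faces_card (induced G (fst G - {v})) d) \<le> boundary_rank K G (Suc d)"
proof -
  let ?D = "induced G (fst G - {v})"
  define \<rho> where "\<rho> c = (\<lambda>\<tau>. if v \<in> \<tau> then 0 else (c \<tau> :: 'k))" for c
  let ?W = "(boundary G (Suc d) :: ('a set \<Rightarrow> 'k) \<Rightarrow> _) ` chains G (Suc d)"
  have WC: "?W \<subseteq> chains G d" by (auto simp: boundary_Suc_in_chains[OF fin])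
  have W: "fs.subspace ?W"
    using fs2.linear_subspace_image[OF linear_boundary[OF fin] subspace_chains] .
  have lin: "Vector_Spaces.linear fscale fscale \<rho>"
    by unfold_locales (auto simp: fun_eq_iff \<rho>_def)
  have "chains ?D d \<subseteq> \<rho> ` ?W"
  proof
    fix e :: "'a set \<Rightarrow> 'k" assume e: "e \<in> chains ?D d"
    \<comment> \<open>The cone over \<open>e\<close>, signed so that removing \<open>v\<close>
      returns \<open>e\<close> itself.\<close>
    define c where "c = (\<lambda>\<sigma>. if v \<in> \<sigma> then face_sign (\<sigma> - {v}) v * e (\<sigma> - {v}) else 0)"
    have c: "c \<in> chains G (Suc d)"
      unfolding chains_def
    proof (intro CollectI allI impI)
      fix \<sigma> assume "c \<sigma> \<noteq> 0"
      then have "v \<in> \<sigma>" "e (\<sigma> - {v}) \<noteq> 0" by (auto simp: c_def split: if_splits)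
      then have "insert v (\<sigma> - {v}) \<in> faces_card G (Suc d)"
        using e faces_card_link[OF fin v] unfolding chains_def cone by blast
      then show "\<sigma> \<in> faces_card G (Suc d)" using \<open>v \<in> \<sigma>\<close> by (simp add: insert_absorb)
    qed
    have "\<rho> (boundary G (Suc d) c) = e"
    proof
      fix \<tau>
      let ?A = "{w. w \<notin> \<tau> \<and> insert w \<tau> \<in> faces_card G (Suc d)}"
      have finA: "finite ?A"
        by (rule finite_subset[OF _ fin]) (use face_subset in blast)
      show "\<rho> (boundary G (Suc d) c) \<tau> = e \<tau>"
      proof (cases "v \<in> \<tau>")
        case True
        then show ?thesis using e by (simp add: \<rho>_def delete_chains)
      next
        case False
        have sq: "face_sign \<tau> v * (face_sign \<tau> v * x) = x" for x :: 'k
          unfolding face_sign_def mult.assoc[symmetric] power_mult_distrib[symmetric] by simp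
        have "\<rho> (boundary G (Suc d) c) \<tau> = (\<Sum>w\<in>?A. face_sign \<tau> w * c (insert w \<tau>))"
          by (simp add: \<rho>_def False boundary_Suc[OF fin])
        \<comment> \<open>The chain \<open>c\<close> lives on faces containing \<open>v\<close>, and
          \<open>\<tau>\<close> does not contain it, so only \<open>w = v\<close>
          contributes.\<close>
        also have "\<dots> = (\<Sum>w\<in>?A. if w = v then e \<tau> else 0)"
          using False by (intro sum.cong) (auto simp: c_def sq)
        also have "\<dots> = (if v \<in> ?A then e \<tau> else 0)" using finA by simp
        also have "\<dots> = e \<tau>"
          using e False faces_card_link[OF fin v, of \<tau> d] unfolding chains_def cone by auto
        finally show ?thesis .
      qed
    qed
    then show "e \<in> \<rho> ` ?W" using c by blast
  qed
  moreover have "\<rho> ` ?W \<subseteq> chains G d"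
  proof
    fix x assume "x \<in> \<rho> ` ?W"
    then obtain w where "w \<in> chains G d" "x = \<rho> w" using WC by blast
    then show "x \<in> chains G d" by (auto simp: chains_def \<rho>_def split: if_splits)
  qed
  ultimately have "fs.dim (chains ?D d :: ('a set \<Rightarrow> 'k) set) \<le> fs.dim (\<rho> ` ?W)"
    by (rule fs_dim_mono[OF fin])
  then show ?thesis
    using fs_rank_nullity[OF fin lin W WC] dim_chains[of ?D d, where 'k='k] fin
    unfolding boundary_rank_def by simp
qed

section \<open>Inequalities between Betti numbers\<close>

lemma red_betti_eq_0:
  assumes "finite (fst G)" "card (fst G) < d"
  shows "red_betti K G d = 0"
  using red_betti_eq[OF assms(1), of K d] faces_card_empty[OF assms] by simp

text \<open>Padding with zeros lets a graph, its deletions and its links be summed over one common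
  range of degrees.\<close>

lemma total_betti_extend:
  assumes "finite (fst G)" "card (fst G) \<le> N"
  shows "total_betti K G = (\<Sum>d\<le>N. red_betti K G d)"
  unfolding total_betti_def
  by (rule sum.mono_neutral_left) (use assms in \<open>auto simp: red_betti_eq_0\<close>)

text \<open>Face numbers add up and ranks are superadditive, so Betti numbers are subadditive. This
  does the work of the long exact sequence of the pair formed by the complex and the deletion, whose
  relative homology is that of the link shifted by one degree.\<close>

lemma red_betti_delete_link:
  fixes K :: "'k::field itself" and G :: "'a::linorder graph"
  assumes fin: "finite (fst G)" and v: "v \<in> fst G"
  shows "red_betti K G (Suc d) \<le> red_betti K (induced G (fst G - {v})) (Suc d) + red_betti K (induced G (nbhd G v)) d"
proof -
  have finL: "finite (fst (induced G (nbhd G v)))" and finD: "finite (fst (induced G (fst G - {v})))"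
    using fin by (auto simp: nbhd_def)
  show ?thesis
    using boundary_rank_delete_link[OF fin v, of K d] boundary_rank_delete_link[OF fin v, of K "Suc d"]
      card_faces_delete_link[OF fin v, of d]
      red_betti_eq[OF fin, of K "Suc d"] red_betti_eq[OF finL, of K d] red_betti_eq[OF finD, of K "Suc d"]
    by linarith
qed

text \<open>In this lowest degree there is no link term: the empty face is the only face, and the
  rank leading into it does not grow under deletion.\<close>

lemma red_betti_delete_0:
  fixes K :: "'k::field itself" and G :: "'a::linorder graph"
  assumes fin: "finite (fst G)"
  shows "red_betti K G 0 \<le> red_betti K (induced G (fst G - {v})) 0"
proof -
  have finD: "finite (fst (induced G (fst G - {v})))" using fin by auto
  show ?thesis
    using boundary_rank_delete[OF fin, of K v "Suc 0"] card_faces_0[OF fin] card_faces_0[OF finD]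
      red_betti_eq[OF fin, of K 0] red_betti_eq[OF finD, of K 0]
    by (simp add: boundary_rank_0)
qed

lemma total_betti_delete_link:
  fixes K :: "'k::field itself" and G :: "'a::linorder graph"
  assumes fin: "finite (fst G)" and v: "v \<in> fst G"
  shows "total_betti K G \<le> total_betti K (induced G (fst G - {v})) + total_betti K (induced G (nbhd G v))"
proof -
  let ?D = "induced G (fst G - {v})" and ?L = "induced G (nbhd G v)" and ?n = "card (fst G)"
  have "total_betti K G \<le> (\<Sum>d\<le>Suc ?n. red_betti K G d)"
    using total_betti_extend[OF fin, of "Suc ?n" K] by simp
  also have "\<dots> = red_betti K G 0 + (\<Sum>d\<le>?n. red_betti K G (Suc d))"
    by (rule sum.atMost_Suc_shift)
  also have "\<dots> \<le> red_betti K ?D 0 + (\<Sum>d\<le>?n. red_betti K ?D (Suc d) + red_betti K ?L d)"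
    by (intro add_mono sum_mono red_betti_delete_0 red_betti_delete_link fin v)
  also have "\<dots> = (\<Sum>d\<le>Suc ?n. red_betti K ?D d) + (\<Sum>d\<le>?n. red_betti K ?L d)"
    by (simp only: sum.atMost_Suc_shift sum.distrib add.assoc)
  also have "(\<Sum>d\<le>Suc ?n. red_betti K ?D d) = total_betti K ?D"
    by (rule total_betti_extend[symmetric]) (use fin card_mono[of "fst G" "fst G - {v}"] in auto)
  also have "(\<Sum>d\<le>?n. red_betti K ?L d) = total_betti K ?L"
    by (rule total_betti_extend[symmetric]) (use fin in \<open>auto simp: nbhd_def intro: card_mono\<close>)
  finally show ?thesis .
qed

text \<open>Link and deletion of the apex coincide, so \<open>G\<close> has f_d + f_{d-1} faces with
  d elements, where f counts faces of the deletion. The two adjacent ranks are at least f_{d-1} and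
  f_d and use up all of them.\<close>

lemma total_betti_cone:
  fixes K :: "'k::field itself" and G :: "'a::linorder graph"
  assumes fin: "finite (fst G)" and v: "v \<in> fst G" and cone: "nbhd G v = fst G - {v}"
  shows "total_betti K G = 0"
proof -
  let ?D = "induced G (fst G - {v})"
  have finD: "finite (fst ?D)" using fin by auto
  have "red_betti K G d = 0" for d
  proof (cases d)
    case 0
    then show ?thesis
      using red_betti_eq[OF fin, of K 0] boundary_rank_cone[OF fin v cone, of 0 K]
        card_faces_0[OF fin] card_faces_0[OF finD] by simp
  next
    case (Suc e)
    then show ?thesis
      using red_betti_eq[OF fin, of K "Suc e"] boundary_rank_cone[OF fin v cone, of e K]
        boundary_rank_cone[OF fin v cone, of "Suc e" K] card_faces_delete_link[OF fin v, of e]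
      unfolding cone by simp
  qed
  then show ?thesis by (simp add: total_betti_def)
qed

lemma nbhd_induced: "v \<in> S \<Longrightarrow> S \<subseteq> fst G \<Longrightarrow> nbhd (induced G S) v = nbhd G v \<inter> S"
  unfolding nbhd_def induced_edge_iff fst_induced by blast

text \<open>When \<open>us ! i\<close> is removed, the vertices before it are already gone, so its
  link lives on its remaining neighbours only. The gain from this shrinking decides the critical
  case of the upper bound.\<close>

lemma total_betti_delete_list:
  fixes K :: "'k::field itself" and G :: "'a::linorder graph"
  assumes "finite (fst G)" "distinct us" "set us \<subseteq> fst G"
  shows "total_betti K G \<le> total_betti K (induced G (fst G - set us)) +
    (\<Sum>i<length us. total_betti K (induced G (nbhd G (us ! i) - set (take i us))))"
  using assms(2,3)
proof (induction us rule: rev_induct)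
  case Nil
  \<comment> \<open>Since \<open>G\<close> is not assumed simple, \<open>induced G (fst G)\<close>
    may lose elements of \<open>snd G\<close> that leave the vertex set; the cliques stay the
    same.\<close>
  have "cl_faces (induced G (fst G)) = cl_faces G"
    unfolding cl_faces_induced[OF order_refl] unfolding cl_faces_def by blast
  then have "faces_card (induced G (fst G)) = faces_card G" by (simp add: faces_card_def fun_eq_iff)
  then have "red_betti K (induced G (fst G)) = red_betti K G"
    by (auto simp: red_betti_def chains_def boundary_def fun_eq_iff)
  then show ?case by (simp add: total_betti_def)
next
  case (snoc u us)
  let ?H = "induced G (fst G - set us)"
  let ?t = "\<lambda>us i. total_betti K (induced G (nbhd G (us ! i) - set (take i us)))"
  have u: "u \<in> fst G - set us" using snoc.prems by auto
  have "nbhd ?H u = nbhd G u - set us"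
    using nbhd_induced[OF u] by (auto simp: nbhd_def)
  then have "induced ?H (nbhd ?H u) = induced G (nbhd G u - set us)"
    using induced_induced[of "nbhd G u - set us" "fst G - set us" G] by (auto simp: nbhd_def)
  moreover have "induced ?H (fst ?H - {u}) = induced G (fst G - set (us @ [u]))"
  proof -
    have "fst G - set (us @ [u]) = fst G - set us - {u}" by auto
    then show ?thesis using induced_induced[of "fst G - set us - {u}" "fst G - set us" G] by simp
  qed
  ultimately have "total_betti K ?H \<le> total_betti K (induced G (fst G - set (us @ [u]))) + ?t (us @ [u]) (length us)"
    using total_betti_delete_link[of ?H u K] u assms(1) by simp
  moreover have "(\<Sum>i<length us. ?t us i) = (\<Sum>i<length us. ?t (us @ [u]) i)"
    by (intro sum.cong) (auto simp: nth_append)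
  ultimately show ?case using snoc by simp
qed

section \<open>Complete multipartite graphs\<close>

lemma multipartite_vertices: "fst (complete_multipartite k s) = (SIGMA i:{..<k}. {..<s i})"
  by (auto simp: complete_multipartite_def)

lemma multipartite_edge_iff: "{x, y} \<in> snd (complete_multipartite k s) \<longleftrightarrow>
    x \<in> fst (complete_multipartite k s) \<and> y \<in> fst (complete_multipartite k s) \<and> fst x \<noteq> fst y"
proof -
  have "{x, y} \<in> snd (complete_multipartite k s)"
    if "x \<in> fst (complete_multipartite k s)" "y \<in> fst (complete_multipartite k s)" "fst x \<noteq> fst y"
    using that unfolding complete_multipartite_def fst_conv snd_conv by blast
  moreover have "x \<in> fst (complete_multipartite k s) \<and> y \<in> fst (complete_multipartite k s) \<and> fst x \<noteq> fst y"
    if e: "{x, y} \<in> snd (complete_multipartite k s)"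
  proof -
    obtain a b where "{x, y} = {a, b}" "a \<in> fst (complete_multipartite k s)"
      "b \<in> fst (complete_multipartite k s)" "fst a \<noteq> fst b"
      using e unfolding complete_multipartite_def fst_conv snd_conv by blast
    then show ?thesis by (metis doubleton_eq_iff)
  qed
  ultimately show ?thesis by blast
qed

text \<open>The graph \<open>K5m 0\<close> has no vertices. The induction uses this to exclude
  \<open>m = 0\<close>, and to exclude \<open>m = 1\<close> once an \<open>I_5\<close> has been
  split off.\<close>

lemma has_induced_copy_K5m_0: "has_induced_copy G (K5m 0)"
  by (simp add: has_induced_copy_def K5m_def multipartite_vertices)

lemma has_induced_copy_induced:
  assumes "S \<subseteq> fst G" "has_induced_copy (induced G S) H"
  shows "has_induced_copy G H"
proof -
  obtain f where f: "inj_on f (fst H)" "f ` fst H \<subseteq> S"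
    "\<forall>u\<in>fst H. \<forall>v\<in>fst H. u \<noteq> v \<longrightarrow> ({u, v} \<in> snd H \<longleftrightarrow> {f u, f v} \<in> snd (induced G S))"
    using assms(2) unfolding has_induced_copy_def fst_induced by blast
  moreover have "{f u, f v} \<in> snd (induced G S) \<longleftrightarrow> {f u, f v} \<in> snd G" if "u \<in> fst H" "v \<in> fst H" for u v
    using that f(2) unfolding induced_edge_iff by blast
  ultimately show ?thesis
    using assms(1) unfolding has_induced_copy_def by (intro exI[of _ f]) auto
qed

text \<open>The five independent vertices \<open>ps\<close>, joined to all of \<open>R\<close>,
  serve as the new part with index \<open>m\<close>.\<close>

lemma has_induced_copy_K5m_Suc:
  assumes R: "R \<subseteq> fst G" "has_induced_copy (induced G R) (K5m m)"
    and ps: "distinct ps" "length ps = 5" "set ps \<subseteq> fst G - R"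
    and indep: "\<And>p q. p \<in> set ps \<Longrightarrow> q \<in> set ps \<Longrightarrow> p \<noteq> q \<Longrightarrow> {p, q} \<notin> snd G"
    and join: "\<And>p r. p \<in> set ps \<Longrightarrow> r \<in> R \<Longrightarrow> {p, r} \<in> snd G"
  shows "has_induced_copy G (K5m (Suc m))"
proof -
  have V: "fst (K5m l) = {..<l} \<times> {..<5}" for l by (auto simp: K5m_def multipartite_vertices)
  have E: "{x, y} \<in> snd (K5m l) \<longleftrightarrow> x \<in> fst (K5m l) \<and> y \<in> fst (K5m l) \<and> fst x \<noteq> fst y" for x y l
    unfolding K5m_def by (rule multipartite_edge_iff)
  obtain f where f: "inj_on f (fst (K5m m))" "f ` fst (K5m m) \<subseteq> R"
    and fe: "\<forall>u\<in>fst (K5m m). \<forall>v\<in>fst (K5m m). u \<noteq> v \<longrightarrow>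
      ({u, v} \<in> snd (K5m m) \<longleftrightarrow> {f u, f v} \<in> snd (induced G R))"
    using R(2) unfolding has_induced_copy_def fst_induced by blast
  define g where "g x = (if fst x < m then f x else ps ! snd x)" for x
  have lo: "g x = f x \<and> f x \<in> R \<and> x \<in> fst (K5m m)" if "x \<in> fst (K5m (Suc m))" "fst x < m" for x
    using that f(2) by (force simp: V g_def)
  have hi: "g x = ps ! snd x \<and> ps ! snd x \<in> set ps \<and> fst x = m \<and> snd x < 5"
    if "x \<in> fst (K5m (Suc m))" "\<not> fst x < m" for x
    using that ps(2) by (auto simp: V g_def)
  have inj: "inj_on g (fst (K5m (Suc m)))"
  proof (rule inj_onI)
    fix x y assume x: "x \<in> fst (K5m (Suc m))" and y: "y \<in> fst (K5m (Suc m))" and eq: "g x = g y"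
    consider "fst x < m" "fst y < m" | "\<not> fst x < m" "\<not> fst y < m" | "fst x < m \<longleftrightarrow> \<not> fst y < m" by blast
    then show "x = y"
    proof cases
      case 1
      then show ?thesis using lo[OF x] lo[OF y] eq f(1) by (metis inj_onD)
    next
      case 2
      then show ?thesis using hi[OF x] hi[OF y] eq ps(1,2) by (metis nth_eq_iff_index_eq prod_eqI)
    next
      case 3
      then show ?thesis using lo[OF x] lo[OF y] hi[OF x] hi[OF y] eq ps(3) by (metis DiffD2 subsetD)
    qed
  qed
  have sub: "g ` fst (K5m (Suc m)) \<subseteq> fst G"
  proof
    fix z assume "z \<in> g ` fst (K5m (Suc m))"
    then obtain x where x: "x \<in> fst (K5m (Suc m))" "z = g x" by blast
    then show "z \<in> fst G" using lo[OF x(1)] hi[OF x(1)] R(1) ps(3) by (cases "fst x < m") auto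
  qed
  have edge: "{x, y} \<in> snd (K5m (Suc m)) \<longleftrightarrow> {g x, g y} \<in> snd G"
    if x: "x \<in> fst (K5m (Suc m))" and y: "y \<in> fst (K5m (Suc m))" and ne: "x \<noteq> y" for x y
  proof -
    have gne: "g x \<noteq> g y" using inj x y ne by (metis inj_onD)
    have EE: "{x, y} \<in> snd (K5m (Suc m)) \<longleftrightarrow> fst x \<noteq> fst y" using E x y by blast
    consider "fst x < m" "fst y < m" | "\<not> fst x < m" "\<not> fst y < m"
      | "fst x < m" "\<not> fst y < m" | "\<not> fst x < m" "fst y < m" by blast
    then show ?thesis
    proof cases
      case 1
      have "fst x \<noteq> fst y \<longleftrightarrow> {f x, f y} \<in> snd (induced G R)"
        using fe[rule_format, of x y] E[of x y m] lo[OF x 1(1)] lo[OF y 1(2)] ne by blast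
      then show ?thesis
        using EE lo[OF x 1(1)] lo[OF y 1(2)] by (simp add: induced_edge_iff)
    next
      case 2
      then show ?thesis using EE hi[OF x 2(1)] hi[OF y 2(2)] indep gne by metis
    next
      case 3
      then show ?thesis using EE lo[OF x 3(1)] hi[OF y 3(2)] join by (metis insert_commute)
    next
      case 4
      then show ?thesis using EE hi[OF x 4(1)] lo[OF y 4(2)] join by metis
    qed
  qed
  show ?thesis unfolding has_induced_copy_def using inj sub edge by blast
qed

section \<open>The upper bound\<close>

abbreviation r3 :: real where "r3 \<equiv> 3 powr (1/4)"

lemma powr_quarter: "3 powr (real n / 4) = r3 ^ n"
  by (simp add: powr_realpow[symmetric] powr_powr)

lemma r3_pow4: "r3 ^ 4 = 3"
  using powr_quarter[of 4] by simp

lemma r3_ge: "13/10 \<le> r3"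
  by (rule power_le_imp_le_base[of _ 3]) (simp_all add: r3_pow4, simp add: power_divide)

text \<open>In integers this is 3^5 \<le> 4^4, the inequality that makes \<open>I_5\<close> better
  than \<open>I_4\<close>; it yields 4 / \<open>r3 ^ 5\<close> \<ge> 1.\<close>

lemma r3_le: "r3 \<le> 4/3"
  by (rule power_le_imp_le_base[of _ 3]) (simp_all add: r3_pow4, simp add: power_divide)

lemma r3_pow5: "r3 ^ 5 = 3 * r3"
  using r3_pow4 by (simp add: power_numeral_reduce)

text \<open>In integers this is k^4 \<le> 3^(k+1), with equality at k = 3, the case of the parts
  \<open>I_4\<close>. At the excluded k = 4 it would read 256 \<le> 243. From 5 on, k + 1 grows by a
  factor of at most 13/10 over k, which is below \<open>r3\<close>.\<close>

lemma le_r3_pow: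
  assumes "k \<noteq> 4"
  shows "real k \<le> r3 ^ Suc k"
proof (cases "k \<le> 3")
  case True
  then consider "k = 0" | "k = 1" | "k = 2" | "k = 3" by linarith
  then show ?thesis
  proof cases
    case 2
    have "1 \<le> r3 * r3" using r3_ge by (intro order_trans[OF _ mult_mono[OF r3_ge r3_ge]]) auto
    then show ?thesis using 2 by simp
  next
    case 3
    have "(13/10) ^ 3 \<le> r3 ^ 3" by (rule power_mono[OF r3_ge]) simp
    then show ?thesis using 3 by (simp add: power_divide numeral_3_eq_3)
  next
    case 4
    then show ?thesis using r3_pow4 by (simp add: numeral_eq_Suc)
  qed simp
next
  case False
  then have "5 \<le> k" using assms by simp
  then show ?thesis
  proof (induction k rule: dec_induct)
    case base
    have "(13/10) ^ 2 \<le> r3 ^ 2" by (rule power_mono[OF r3_ge]) simp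
    moreover have "r3 ^ 6 = 3 * r3 ^ 2" using r3_pow4 by (simp add: power_numeral_reduce)
    ultimately show ?case by (simp add: power_divide)
  next
    case (step k)
    have "real (Suc k) \<le> 13/10 * real k" using step.hyps by simp
    also have "\<dots> \<le> r3 * r3 ^ Suc k" by (rule mult_mono[OF r3_ge step.IH]) auto
    finally show ?case by simp
  qed
qed

text \<open>Settles k = 4 when some link is smaller than D: three links on at most D vertices and
  one on at most D - 1 give 3 * \<open>r3\<close> + 1 in units of \<open>r3\<close> to the power D -
  1, while n = D + 5 exceeds D - 1 by 6.\<close>

lemma r3_pow6_ge: "3 * r3 + 1 \<le> r3 ^ 6"
proof -
  have "1 \<le> 3 * (r3 * (r3 - 1))"
    using mult_mono[of "13/10" r3 "3/10" "r3 - 1"] r3_ge by simp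
  moreover have "r3 ^ 6 = 3 * r3 ^ 2" using r3_pow4 by (simp add: power_numeral_reduce)
  ultimately show ?thesis by (simp add: algebra_simps power2_eq_square)
qed

lemma nbhd_sym: "u \<in> nbhd G v \<Longrightarrow> v \<in> fst G \<Longrightarrow> v \<in> nbhd G u"
  by (auto simp: nbhd_def insert_commute)

text \<open>Let \<open>k\<close> be the number of non-neighbours of a vertex of maximum degree. For \<open>k \<noteq> 4\<close> the estimate
  \<open>k \<le> 3 powr ((k + 1) / 4)\<close> closes the induction. For \<open>k = 4\<close> it fails, but either some link loses
  a further vertex, or \<open>G\<close> is the join of \<open>I_5\<close> and a graph without induced \<open>K_{5,...,5}\<close>
  on \<open>m - 1\<close> parts.\<close>

lemma total_betti_upper_bound:
  fixes K :: "'k::field itself" and G :: "'a::linorder graph"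
  assumes "finite (fst G)" "\<not> has_induced_copy G (K5m m)"
  shows "real (total_betti K G) \<le> (4 / r3 ^ 5) ^ (m - 1) * r3 ^ card (fst G)"
  using assms
proof (induction "card (fst G)" arbitrary: G m rule: less_induct)
  case less
  note fin = less.prems(1)
  let ?A = "(4 / r3 ^ 5) ^ (m - 1)"
  let ?t = "\<lambda>S. total_betti K (induced G S)"
  have base1: "1 \<le> 4 / r3 ^ 5"
    using r3_le by (simp add: r3_pow5 field_simps)
  have A: "1 \<le> ?A" using base1 by (rule one_le_power)
  have r3: "1 \<le> r3" using r3_ge by simp
  show ?case
  proof (cases "fst G = {}")
    case True
    then have "int (total_betti K G) = int (red_betti K G 0)" by (simp add: total_betti_def)
    also have "\<dots> \<le> 1" using red_betti_eq[OF fin, of K 0] card_faces_0[OF fin] by simp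
    finally show ?thesis using A True by simp
  next
    case False
    define D where "D = Max ((\<lambda>v. card (nbhd G v)) ` fst G)"
    have "D \<in> (\<lambda>v. card (nbhd G v)) ` fst G" unfolding D_def using False fin by (intro Max_in) auto
    then obtain v where v: "v \<in> fst G" and Dv: "D = card (nbhd G v)" by blast
    have D_max: "card (nbhd G u) \<le> D" if "u \<in> fst G" for u
      unfolding D_def using that fin by (intro Max_ge) auto
    have finN: "finite (nbhd G u)" for u using fin by (simp add: nbhd_def)
    have NV: "nbhd G u \<subseteq> fst G - {u}" for u by (auto simp: nbhd_def)
    obtain us where us: "set us = fst G - {v} - nbhd G v" "distinct us"
      using finite_distinct_list[of "fst G - {v} - nbhd G v"] fin by auto
    define k where "k = length us"
    define L where "L i = nbhd G (us ! i) - set (take i us)" for i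
    have V: "fst G = insert v (nbhd G v \<union> set us)" using us(1) v NV by blast
    have vN: "v \<notin> nbhd G v" by (simp add: nbhd_def)
    have "card (fst G) = Suc (card (nbhd G v \<union> set us))"
      using V vN us(1) finN by (metis (no_types, lifting) Diff_iff List.finite_set UnE card_insert_disjoint finite_Un insertI1)
    also have "card (nbhd G v \<union> set us) = D + k"
      unfolding Dv k_def distinct_card[OF us(2), symmetric]
      by (rule card_Un_disjoint) (use us(1) finN fin in auto)
    finally have n: "card (fst G) = Suc (D + k)" .
    have "fst G - set us = insert v (nbhd G v)" using V us(1) vN by auto
    then have "total_betti K (induced G (fst G - set us)) = 0"
      using v vN NV[of v] finN nbhd_induced[of v "insert v (nbhd G v)" G]
      by (intro total_betti_cone[of _ v]) auto
    then have sum: "total_betti K G \<le> (\<Sum>i<k. ?t (L i))"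
      using total_betti_delete_list[OF fin us(2), of K] us(1) unfolding k_def L_def by auto
    have usV: "us ! i \<in> set us" "us ! i \<in> fst G" if "i < k" for i
      using that us(1) nth_mem[of i us] unfolding k_def by auto
    have LD: "card (L i) \<le> D" if "i < k" for i
    proof -
      have "card (L i) \<le> card (nbhd G (us ! i))" unfolding L_def by (intro card_mono finN) auto
      also have "\<dots> \<le> D" using D_max usV[OF that] by blast
      finally show ?thesis .
    qed
    have LV: "L i \<subseteq> fst G" for i using NV unfolding L_def by blast
    have IH: "real (?t (L i)) \<le> ?A * r3 ^ card (L i)" if "i < k" for i
    proof -
      have "\<not> has_induced_copy (induced G (L i)) (K5m m)"
        using has_induced_copy_induced[OF LV] less.prems(2) by blast
      then show ?thesis
        using less.hyps[of "induced G (L i)" m] LD[OF that] n finite_subset[OF LV fin] by simp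
    qed
    have tD: "real (?t (L i)) \<le> ?A * r3 ^ D" if "i < k" for i
      using IH[OF that] mult_left_mono[OF power_increasing[OF LD[OF that] r3], of ?A] A by linarith
    show ?thesis
    proof (cases "k = 4")
      \<comment> \<open>This includes k = 0, where \<open>v\<close> is adjacent to all other
        vertices and the sum is empty.\<close>
      case False
      have "real (total_betti K G) \<le> (\<Sum>i<k. real (?t (L i)))"
        using sum by (metis of_nat_le_iff of_nat_sum)
      also have "\<dots> \<le> (\<Sum>i<k. ?A * r3 ^ D)" using tD by (intro sum_mono) auto
      also have "\<dots> = (?A * r3 ^ D) * real k" by simp
      also have "\<dots> \<le> (?A * r3 ^ D) * r3 ^ Suc k"
        using le_r3_pow[OF False] A by (intro mult_left_mono) auto
      also have "\<dots> = ?A * r3 ^ card (fst G)" by (simp add: n power_add)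
      finally show ?thesis .
    next
      case k: True
      show ?thesis
      proof (cases "\<exists>j<k. card (L j) < D")
        case True
        then obtain j where j: "j < k" "card (L j) < D" by blast
        then obtain D' where D': "D = Suc D'" by (cases D) auto
        have tj: "real (?t (L j)) \<le> ?A * r3 ^ D'"
        proof -
          have "r3 ^ card (L j) \<le> r3 ^ D'" using j D' by (intro power_increasing r3) auto
          then show ?thesis using IH[OF j(1)] mult_left_mono[of "r3 ^ card (L j)" "r3 ^ D'" ?A] A by linarith
        qed
        have "real (total_betti K G) \<le> (\<Sum>i<k. real (?t (L i)))"
          using sum by (metis of_nat_le_iff of_nat_sum)
        also have "\<dots> = real (?t (L j)) + (\<Sum>i\<in>{..<k} - {j}. real (?t (L i)))"
          using j by (intro sum.remove) auto
        also have "\<dots> \<le> ?A * r3 ^ D' + (\<Sum>i\<in>{..<k} - {j}. ?A * r3 ^ D)"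
          using tj tD by (intro add_mono sum_mono) auto
        also have "\<dots> = (?A * r3 ^ D') * (3 * r3 + 1)"
          using j k by (simp add: D' algebra_simps)
        also have "\<dots> \<le> (?A * r3 ^ D') * r3 ^ 6"
          using r3_pow6_ge A by (intro mult_left_mono) auto
        also have "\<dots> = ?A * r3 ^ card (fst G)"
          by (simp add: n k D' power_add[symmetric])
        finally show ?thesis .
      next
        case False
        \<comment> \<open>If no link is smaller than D, then no earlier vertex of \<open>us\<close>
          was a neighbour of a later one, and all of these vertices attain the maximum degree. Hence
          \<open>us\<close> is independent.\<close>
        have full: "L i = nbhd G (us ! i) \<and> card (nbhd G (us ! i)) = D" if "i < k" for i
        proof -
          have 1: "D \<le> card (L i)" using False that by (meson not_le)
          have sub: "L i \<subseteq> nbhd G (us ! i)" unfolding L_def by blast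
          have 2: "card (nbhd G (us ! i)) \<le> D" using D_max usV[OF that] by blast
          have "card (L i) \<le> card (nbhd G (us ! i))" by (rule card_mono[OF finN sub])
          then have "card (L i) = card (nbhd G (us ! i))" using 1 2 by linarith
          then show ?thesis using card_subset_eq[OF finN sub] 1 LD[OF that] by simp
        qed
        have earlier: "us ! j \<notin> nbhd G (us ! i)" if "j < i" "i < k" for i j
        proof -
          have "us ! j \<in> set (take i us)"
            using that by (auto simp: in_set_conv_nth k_def intro!: exI[of _ j])
          then show ?thesis using full[OF that(2)] unfolding L_def by blast
        qed
        have nonadj: "us ! j \<notin> nbhd G (us ! i)" if "j < k" "i < k" for i j
        proof (cases j i rule: linorder_cases)
          case less
          then show ?thesis using earlier that by blast
        next
          case equal
          then show ?thesis by (simp add: nbhd_def)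
        next
          case greater
          then show ?thesis using earlier[OF greater that(1)] nbhd_sym usV[OF that(2)] by metis
        qed
        \<comment> \<open>The neighbourhood avoids \<open>v\<close> and \<open>us\<close>, so it
          lies in that of \<open>v\<close>; both have D elements. Thus \<open>v\<close> and
          \<open>us\<close> form an \<open>I_5\<close> joined to everything else.\<close>
        have nbhd_eq: "nbhd G (us ! i) = nbhd G v" if i: "i < k" for i
        proof -
          have "v \<notin> nbhd G (us ! i)"
            using nbhd_sym[of v G "us ! i"] usV[OF i] us(1) by blast
          moreover have "nbhd G (us ! i) \<inter> set us = {}"
            using nonadj[OF _ i] by (auto simp: in_set_conv_nth k_def)
          moreover have "nbhd G (us ! i) - {v} - nbhd G v \<subseteq> set us" using NV[of "us ! i"] unfolding us(1) by blast
          ultimately have "nbhd G (us ! i) \<subseteq> nbhd G v" by blast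
          then show ?thesis using full[OF i] Dv card_subset_eq[OF finN] by metis
        qed
        have adj: "nbhd G p = nbhd G v" if "p \<in> set (v # us)" for p
          using that nbhd_eq by (auto simp: in_set_conv_nth k_def)
        have not_nbhd: "p \<notin> nbhd G v" if "p \<in> set (v # us)" for p using that us(1) vN by auto
        have "has_induced_copy G (K5m (Suc m'))"
          if "has_induced_copy (induced G (nbhd G v)) (K5m m')" for m'
        proof (rule has_induced_copy_K5m_Suc[OF _ that, of "v # us"])
          show "nbhd G v \<subseteq> fst G" using NV by blast
          show "distinct (v # us)" "length (v # us) = 5" using us k by (auto simp: k_def)
          show "set (v # us) \<subseteq> fst G - nbhd G v" using us(1) v vN by auto
          show "{p, q} \<notin> snd G" if "p \<in> set (v # us)" "q \<in> set (v # us)" "p \<noteq> q" for p q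
          proof
            assume "{p, q} \<in> snd G"
            moreover have "q \<in> fst G" using that(2) us(1) v by auto
            ultimately have "q \<in> nbhd G p" using that(3) by (simp add: nbhd_def)
            then show False using adj[OF that(1)] not_nbhd[OF that(2)] by simp
          qed
          show "{p, r} \<in> snd G" if "p \<in> set (v # us)" "r \<in> nbhd G v" for p r
            using adj[OF that(1)] that(2) by (auto simp: nbhd_def)
        qed
        then have free: "\<not> has_induced_copy (induced G (nbhd G v)) (K5m (m - 1))"
          using less.prems(2) has_induced_copy_K5m_0[of G] by (cases m) auto
        \<comment> \<open>For \<open>m = 1\<close> the five vertices would already be a copy of H.
          So the exponent \<open>m - 1\<close> is positive and can drop by one.\<close>
        then obtain m' where m: "m - 1 = Suc m'"
          using has_induced_copy_K5m_0[of "induced G (nbhd G v)"] by (cases "m - 1") auto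
        have "real (?t (nbhd G v)) \<le> (4 / r3 ^ 5) ^ m' * r3 ^ D"
          using less.hyps[OF _ _ free, unfolded m] n Dv finN by simp
        moreover have "total_betti K G \<le> (\<Sum>i<k. ?t (nbhd G v))"
          using sum full nbhd_eq by simp
        ultimately have "real (total_betti K G) \<le> 4 * ((4 / r3 ^ 5) ^ m' * r3 ^ D)"
          using k by simp
        \<comment> \<open>Four equal links cost a factor 4 and the five vertices split off account
          for \<open>r3 ^ 5\<close>; the quotient is exactly one more factor of the
          constant.\<close>
        also have "\<dots> = (4 / r3 ^ 5) ^ Suc m' * (r3 ^ 5 * r3 ^ D)" by simp
        also have "r3 ^ 5 * r3 ^ D = r3 ^ card (fst G)"
          by (simp add: n k power_add[symmetric] add.commute)
        also have "(4 / r3 ^ 5) ^ Suc m' = ?A" by (simp only: m)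
        finally show ?thesis .
      qed
    qed
  qed
qed

section \<open>The lower bound through the Euler characteristic\<close>

lemma alternating_telescope:
  fixes r :: "nat \<Rightarrow> int"
  shows "(\<Sum>d\<le>N. (-1) ^ d * (r d + r (Suc d))) = r 0 + (-1) ^ N * r (Suc N)"
  by (induction N) (auto simp: algebra_simps)

text \<open>Euler-Poincare: in the alternating sum every rank occurs twice with opposite signs.
  Signing by cardinality instead of dimension gives the negative of the reduced Euler
  characteristic, which the absolute value hides.\<close>

lemma euler_le_total_betti:
  fixes K :: "'k::field itself" and G :: "'a::linorder graph"
  assumes fin: "finite (fst G)"
  shows "\<bar>\<Sum>\<sigma>\<in>cl_faces G. (-1) ^ card \<sigma>\<bar> \<le> int (total_betti K G)"
proof -
  let ?n = "card (fst G)" and ?r = "\<lambda>d. int (boundary_rank K G d)"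
  \<comment> \<open>There are no faces in this degree, and a Betti number is nonnegative, so the
    rank left over by the telescoping vanishes.\<close>
  have r: "?r (Suc ?n) = 0"
    using red_betti_eq[OF fin, of K "Suc ?n"] faces_card_empty[OF fin, of "Suc ?n"] by simp
  have "card ` cl_faces G \<subseteq> {..?n}"
    using card_mono[OF fin] unfolding cl_faces_def by blast
  then have "(\<Sum>\<sigma>\<in>cl_faces G. (-1) ^ card \<sigma> :: int) =
      (\<Sum>d\<le>?n. \<Sum>\<sigma>\<in>{\<sigma>\<in>cl_faces G. card \<sigma> = d}. (-1) ^ card \<sigma>)"
    by (intro sum.group[symmetric] finite_cl_faces fin) auto
  also have "\<dots> = (\<Sum>d\<le>?n. (-1) ^ d * int (card (faces_card G d)))"
    by (intro sum.cong) (auto simp: faces_card_def)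
  also have "\<dots> = (\<Sum>d\<le>?n. (-1) ^ d * int (red_betti K G d) + (-1) ^ d * (?r d + ?r (Suc d)))"
    by (intro sum.cong) (auto simp: red_betti_eq[OF fin] algebra_simps)
  also have "\<dots> = (\<Sum>d\<le>?n. (-1) ^ d * int (red_betti K G d))"
    unfolding sum.distrib alternating_telescope[of ?r] by (simp add: r boundary_rank_0)
  also have "\<bar>\<dots>\<bar> \<le> (\<Sum>d\<le>?n. \<bar>(-1) ^ d * int (red_betti K G d)\<bar>)" by (rule sum_abs)
  also have "\<dots> = int (total_betti K G)" by (simp add: total_betti_def abs_mult power_abs)
  finally show ?thesis .
qed

section \<open>Euler characteristics of complete multipartite graphs\<close>

lemma finite_multipartite: "finite (fst (complete_multipartite k s))"
  by (simp add: multipartite_vertices)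

lemma multipartite_face_iff:
  "\<sigma> \<in> cl_faces (complete_multipartite k s) \<longleftrightarrow>
    \<sigma> \<subseteq> (SIGMA i:{..<k}. {..<s i}) \<and> inj_on fst \<sigma>"
  unfolding cl_faces_def multipartite_edge_iff multipartite_vertices inj_on_def by blast

text \<open>A clique contains at most one vertex of each part. The last part thus contributes a
  factor: 1 for avoiding it and -1 for each of its \<open>s k\<close> vertices.\<close>

lemma euler_multipartite:
  "(\<Sum>\<sigma>\<in>cl_faces (complete_multipartite k s). (-1) ^ card \<sigma>) = (\<Prod>i<k. 1 - int (s i))"
proof (induction k)
  case 0
  have "cl_faces (complete_multipartite 0 s) = {{}}" by (auto simp: multipartite_face_iff)
  then show ?case by simp
next
  case (Suc k)
  let ?F = "cl_faces (complete_multipartite k s)" and ?F' = "cl_faces (complete_multipartite (Suc k) s)"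
  let ?h = "\<lambda>(j, \<tau>). insert (k, j) \<tau>"
  let ?T = "{..<s k} \<times> ?F"
  have new: "(k, j) \<notin> \<tau>" if "\<tau> \<in> ?F" for \<tau> j using that by (auto simp: multipartite_face_iff)
  have finF: "finite \<tau>" if "\<tau> \<in> ?F" for \<tau>
    using that finite_multipartite finite_subset by (fastforce simp: multipartite_face_iff)
  have "?F' = ?F \<union> ?h ` ?T"
  proof (intro set_eqI iffI)
    fix \<sigma> assume \<sigma>: "\<sigma> \<in> ?F'"
    show "\<sigma> \<in> ?F \<union> ?h ` ?T"
    proof (cases "\<exists>j. (k, j) \<in> \<sigma>")
      case True
      then obtain j where j: "(k, j) \<in> \<sigma>" by blast
      have "x \<in> (SIGMA i:{..<k}. {..<s i})" if "x \<in> \<sigma> - {(k, j)}" for x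
      proof -
        have "fst x \<noteq> k" using that j \<sigma> inj_onD[of fst \<sigma> x "(k, j)"] by (auto simp: multipartite_face_iff)
        moreover have "x \<in> (SIGMA i:{..<Suc k}. {..<s i})" using that \<sigma> by (auto simp: multipartite_face_iff)
        ultimately show ?thesis by (auto simp: less_Suc_eq)
      qed
      then have "\<sigma> - {(k, j)} \<in> ?F"
        using \<sigma> by (auto simp: multipartite_face_iff inj_on_diff)
      moreover have "j < s k" using j \<sigma> by (auto simp: multipartite_face_iff)
      moreover have "\<sigma> = insert (k, j) (\<sigma> - {(k, j)})" using j by blast
      ultimately show ?thesis by (intro UnI2 image_eqI[of _ _ "(j, \<sigma> - {(k, j)})"]) auto
    next
      case False
      have "x \<in> (SIGMA i:{..<k}. {..<s i})" if "x \<in> \<sigma>" for x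
      proof -
        have "fst x \<noteq> k" using False that by (metis prod.collapse)
        moreover have "x \<in> (SIGMA i:{..<Suc k}. {..<s i})" using that \<sigma> by (auto simp: multipartite_face_iff)
        ultimately show ?thesis by (auto simp: less_Suc_eq)
      qed
      then show ?thesis using \<sigma> by (auto simp: multipartite_face_iff)
    qed
  next
    fix \<sigma> assume "\<sigma> \<in> ?F \<union> ?h ` ?T"
    then consider "\<sigma> \<in> ?F" | j \<tau> where "j < s k" "\<tau> \<in> ?F" "\<sigma> = insert (k, j) \<tau>" by auto
    then show "\<sigma> \<in> ?F'"
    proof cases
      case 1
      then show ?thesis by (force simp: multipartite_face_iff)
    next
      case 2
      then have "k \<notin> fst ` \<tau>" by (force simp: multipartite_face_iff)
      then show ?thesis using 2 by (force simp: multipartite_face_iff)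
    qed
  qed
  moreover have "?F \<inter> ?h ` ?T = {}" by (auto simp: multipartite_face_iff)
  moreover have "inj_on ?h ?T"
  proof (rule inj_onI, clarify)
    fix j \<tau> j' \<tau>' assume *: "\<tau> \<in> ?F" "\<tau>' \<in> ?F" "insert (k, j) \<tau> = insert (k, j') \<tau>'"
    have "j = j'" using * new by (metis insert_iff prod.inject)
    then show "j = j' \<and> \<tau> = \<tau>'" using * new by (metis insert_ident)
  qed
  moreover have fin: "finite ?F" "finite ?T" using finite_cl_faces[OF finite_multipartite] by auto
  ultimately have "(\<Sum>\<sigma>\<in>?F'. (-1) ^ card \<sigma> :: int) =
      (\<Sum>\<sigma>\<in>?F. (-1) ^ card \<sigma>) + (\<Sum>x\<in>?T. (-1) ^ card (?h x))"
    by (simp add: sum.union_disjoint sum.reindex)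
  also have "(\<Sum>x\<in>?T. (-1) ^ card (?h x) :: int) = (\<Sum>x\<in>?T. - ((-1) ^ card (snd x)))"
    using new finF by (intro sum.cong) auto
  also have "\<dots> = (\<Sum>j<s k. \<Sum>\<tau>\<in>?F. - ((-1) ^ card \<tau>))"
    unfolding sum.cartesian_product by (intro sum.cong) auto
  also have "\<dots> = - int (s k) * (\<Sum>\<tau>\<in>?F. (-1) ^ card \<tau>)" by (simp add: sum_negf)
  finally show ?case by (simp add: Suc.IH algebra_simps)
qed

text \<open>The maximum in \<open>b_H\<close> runs over graphs on \<open>nat\<close>, while the
  extremal join lives on pairs. The encoding \<open>prod_encode\<close> does not respect the
  lexicographic order on which the boundary signs depend, so only cliques, simplicity and induced
  copies are transported, not homology.\<close>

definition map_graph :: "('a \<Rightarrow> 'b) \<Rightarrow> 'a graph \<Rightarrow> 'b graph" where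
  "map_graph e G = (e ` fst G, (`) e ` snd G)"

lemma map_graph_edge_iff:
  assumes "inj e"
  shows "{e u, e v} \<in> snd (map_graph e G) \<longleftrightarrow> {u, v} \<in> snd G"
proof -
  have "{e u, e v} = e ` {u, v}" by simp
  then show ?thesis by (simp only: map_graph_def snd_conv image_iff inj_image_eq_iff[OF assms]) blast
qed

lemma simple_map_graph:
  assumes "inj e" "simple_graph G"
  shows "simple_graph (map_graph e G)"
  using assms unfolding simple_graph_def map_graph_def
  by (auto simp: card_image[OF inj_on_subset[OF assms(1)]])

lemma cl_faces_map_graph:
  assumes "inj e"
  shows "cl_faces (map_graph e G) = (`) e ` cl_faces G"
proof (intro set_eqI iffI)
  fix \<sigma> assume \<sigma>: "\<sigma> \<in> cl_faces (map_graph e G)"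
  then have "\<sigma> \<subseteq> e ` fst G" by (simp add: cl_faces_def map_graph_def)
  then obtain \<tau> where \<tau>: "\<tau> \<subseteq> fst G" "\<sigma> = e ` \<tau>" by (auto simp: subset_image_iff)
  have "{u, v} \<in> snd G" if "u \<in> \<tau>" "v \<in> \<tau>" "u \<noteq> v" for u v
  proof -
    have "e u \<in> \<sigma>" "e v \<in> \<sigma>" "e u \<noteq> e v" using that \<tau>(2) injD[OF assms] by auto
    then have "{e u, e v} \<in> snd (map_graph e G)" using \<sigma> unfolding cl_faces_def by blast
    then show ?thesis by (simp add: map_graph_edge_iff[OF assms])
  qed
  then have "\<tau> \<in> cl_faces G" using \<tau>(1) by (simp add: cl_faces_def)
  then show "\<sigma> \<in> (`) e ` cl_faces G" using \<tau>(2) by blast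
next
  fix \<sigma> assume "\<sigma> \<in> (`) e ` cl_faces G"
  then obtain \<tau> where \<tau>: "\<tau> \<in> cl_faces G" "\<sigma> = e ` \<tau>" by blast
  have "{e u, e v} \<in> snd (map_graph e G)" if "u \<in> \<tau>" "v \<in> \<tau>" "e u \<noteq> e v" for u v
  proof -
    have "u \<noteq> v" using that(3) by blast
    then show ?thesis using \<tau>(1) that(1,2) unfolding map_graph_edge_iff[OF assms] cl_faces_def by blast
  qed
  moreover have "e ` \<tau> \<subseteq> fst (map_graph e G)" using \<tau>(1) by (auto simp: cl_faces_def map_graph_def)
  ultimately show "\<sigma> \<in> cl_faces (map_graph e G)"
    unfolding \<tau>(2) by (simp add: cl_faces_def)
qed

lemma euler_map_graph:
  assumes "inj e"
  shows "(\<Sum>\<sigma>\<in>cl_faces (map_graph e G). (-1) ^ card \<sigma> :: int) = (\<Sum>\<sigma>\<in>cl_faces G. (-1) ^ card \<sigma>)"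
  unfolding cl_faces_map_graph[OF assms]
  by (subst sum.reindex) (auto simp: inj_on_def inj_image_eq_iff[OF assms] card_image[OF inj_on_subset[OF assms]])

lemma has_induced_copy_map_graph:
  assumes "inj e" "has_induced_copy (map_graph e G) H"
  shows "has_induced_copy G H"
proof -
  obtain f where f: "inj_on f (fst H)" "f ` fst H \<subseteq> e ` fst G"
    "\<forall>u\<in>fst H. \<forall>v\<in>fst H. u \<noteq> v \<longrightarrow> ({u, v} \<in> snd H \<longleftrightarrow> {f u, f v} \<in> snd (map_graph e G))"
    using assms(2) unfolding has_induced_copy_def by (auto simp: map_graph_def)
  define g where "g = inv e \<circ> f"
  have eg: "e (g u) = f u" if "u \<in> fst H" for u
    using that f(2) unfolding g_def by (auto intro!: f_inv_into_f)
  have "inj_on g (fst H)" by (rule inj_onI) (metis eg f(1) inj_onD)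
  moreover have "g ` fst H \<subseteq> fst G"
  proof
    fix y assume "y \<in> g ` fst H"
    then obtain u where u: "u \<in> fst H" "y = g u" by blast
    then have "e y \<in> e ` fst G" using eg f(2) by auto
    then show "y \<in> fst G" using inj_image_mem_iff[OF assms(1)] by metis
  qed
  moreover have "{u, v} \<in> snd H \<longleftrightarrow> {g u, g v} \<in> snd G" if "u \<in> fst H" "v \<in> fst H" "u \<noteq> v" for u v
    using f(3)[rule_format, OF that] map_graph_edge_iff[OF assms(1), of "g u" "g v" G] eg that by simp
  ultimately show ?thesis unfolding has_induced_copy_def by blast
qed

text \<open>Lying in one part is the same as being equal or non-adjacent, so a copy sends each part
  of H injectively into a single part, and different parts into different ones. Only m - 1 parts can
  hold five vertices, whereas H has m.\<close>

lemma join_I5_I4_free: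
  assumes "m \<ge> 1"
  shows "\<not> has_induced_copy (join_I5_I4 m q) (K5m m)"
proof
  let ?s = "\<lambda>i. if i < m - 1 then 5 else 4 :: nat"
  let ?G = "complete_multipartite (m - 1 + q) ?s" and ?H = "complete_multipartite m (\<lambda>_. 5)"
  assume "has_induced_copy (join_I5_I4 m q) (K5m m)"
  then obtain f where f: "inj_on f (fst ?H)" "f ` fst ?H \<subseteq> fst ?G"
    "\<forall>u\<in>fst ?H. \<forall>v\<in>fst ?H. u \<noteq> v \<longrightarrow> ({u, v} \<in> snd ?H \<longleftrightarrow> {f u, f v} \<in> snd ?G)"
    unfolding has_induced_copy_def join_I5_I4_def K5m_def by blast
  have H: "fst ?H = {..<m} \<times> {..<5}" by (simp add: multipartite_vertices)
  have same: "fst (f u) = fst (f v) \<longleftrightarrow> fst u = fst v" if "u \<in> fst ?H" "v \<in> fst ?H" for u v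
  proof (cases "u = v")
    case False
    have "f u \<in> fst ?G" "f v \<in> fst ?G" using that f(2) by blast+
    then show ?thesis
      using f(3)[rule_format, OF that False] that unfolding multipartite_edge_iff by blast
  qed simp
  define p where "p i = fst (f (i, 0))" for i
  have p: "p i < m - 1" if i: "i < m" for i
  proof -
    have inH: "(i, j) \<in> fst ?H" if "j < 5" for j using i that by (simp add: H)
    have "(\<lambda>j. f (i, j)) ` {..<5} \<subseteq> {p i} \<times> {..<?s (p i)}"
    proof
      fix y assume "y \<in> (\<lambda>j. f (i, j)) ` {..<5}"
      then obtain j where j: "j < 5" "y = f (i, j)" by blast
      have "fst y = p i" using same[OF inH[OF j(1)] inH[of 0]] j(2) by (simp add: p_def)
      moreover have "y \<in> fst ?G" using f(2) inH[OF j(1)] j(2) by blast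
      ultimately show "y \<in> {p i} \<times> {..<?s (p i)}" by (auto simp: multipartite_vertices)
    qed
    then have "card ((\<lambda>j. f (i, j)) ` {..<5}) \<le> card ({p i} \<times> {..<?s (p i)})"
      by (rule card_mono[rotated]) simp
    moreover have "inj_on (\<lambda>j. f (i, j)) {..<5}"
      by (rule inj_onI) (use inj_onD[OF f(1)] inH in blast)
    ultimately have "5 \<le> ?s (p i)" by (simp add: card_image card_cartesian_product_singleton)
    then show ?thesis by (simp split: if_splits)
  qed
  have "inj_on p {..<m}"
  proof (rule inj_onI)
    fix i j assume "i \<in> {..<m}" "j \<in> {..<m}" "p i = p j"
    then show "i = j" using same[of "(i, 0)" "(j, 0)"] by (simp add: H p_def)
  qed
  moreover have "p ` {..<m} \<subseteq> {..<m - 1}" using p by auto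
  ultimately have "card {..<m} \<le> card {..<m - 1}" by (rule card_inj_on_le) simp
  then show False using assms by simp
qed

lemma simple_multipartite: "simple_graph (complete_multipartite k s)"
  unfolding simple_graph_def
proof (intro conjI ballI)
  show "finite (fst (complete_multipartite k s))" by (rule finite_multipartite)
  fix e assume e: "e \<in> snd (complete_multipartite k s)"
  then obtain x y where "e = {x, y}" unfolding complete_multipartite_def by auto
  moreover from this have "x \<in> fst (complete_multipartite k s)" "y \<in> fst (complete_multipartite k s)" "fst x \<noteq> fst y"
    using e multipartite_edge_iff[of x y k s] by blast+
  moreover from this have "x \<noteq> y" by blast
  ultimately show "e \<subseteq> fst (complete_multipartite k s)" "card e = 2" by auto
qed

lemma join_parts: "(\<Prod>i<a + q. if i < a then x else y) = (x :: 'a::comm_monoid_mult) ^ a * y ^ q"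
  by (induction q) (auto simp: ac_simps)

lemma card_join_I5_I4: "card (fst (join_I5_I4 m q)) = 5 * (m - 1) + 4 * q"
proof -
  have "(\<Sum>i<a + q. if i < a then 5 else 4) = 5 * a + 4 * q" for a :: nat
    by (induction q) auto
  then show ?thesis by (simp add: join_I5_I4_def multipartite_vertices)
qed

lemma euler_join_I5_I4:
  "\<bar>\<Sum>\<sigma>\<in>cl_faces (join_I5_I4 m q). (-1) ^ card \<sigma>\<bar> = (4 ^ (m - 1) * 3 ^ q :: int)"
proof -
  have "(\<Sum>\<sigma>\<in>cl_faces (join_I5_I4 m q). (-1) ^ card \<sigma>) =
      (\<Prod>i<m - 1 + q. if i < m - 1 then -4 else - 3 :: int)"
    unfolding join_I5_I4_def euler_multipartite by (intro prod.cong) auto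
  then show ?thesis unfolding join_parts by (simp add: abs_mult power_abs)
qed

text \<open>Each \<open>I_5\<close> contributes 4 / \<open>r3 ^ 5\<close> times
  \<open>r3 ^ 5\<close>, and each \<open>I_4\<close> contributes \<open>r3 ^ 4\<close> = 3.\<close>

lemma bound_join_I5_I4:
  "(4 / r3 ^ 5) ^ (m - 1) * r3 ^ (5 * (m - 1) + 4 * q) = 4 ^ (m - 1) * 3 ^ q"
  by (simp add: power_add power_mult r3_pow4 power_divide)

theorem theorem1p3:
  fixes K :: "'k::field itself" and m n :: nat
  assumes "m \<ge> 1"
  shows "real (b_H K (K5m m) n) \<le> (4 / 3 powr (5/4)) ^ (m - 1) * 3 powr (real n / 4) \<and>
         (n > 5 * (m - 1) \<and> 4 dvd (n - 5 * (m - 1)) \<longrightarrow>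
           (let q = (n - 5 * (m - 1)) div 4; G = join_I5_I4 m q in
              simple_graph G \<and> card (fst G) = n \<and> \<not> has_induced_copy G (K5m m) \<and>
              real (total_betti K G) = (4 / 3 powr (5/4)) ^ (m - 1) * 3 powr (real n / 4) \<and>
              real (b_H K (K5m m) n) = (4 / 3 powr (5/4)) ^ (m - 1) * 3 powr (real n / 4)))"
proof -
  let ?B = "(4 / 3 powr (5/4)) ^ (m - 1) * 3 powr (real n / 4)"
  let ?S = "{total_betti K (G :: nat graph) | G.
      simple_graph G \<and> card (fst G) \<le> n \<and> \<not> has_induced_copy G (K5m m)}"
  have B: "?B = (4 / r3 ^ 5) ^ (m - 1) * r3 ^ n"
    using powr_quarter[of 5] powr_quarter[of n] by simp
  have ub: "real t \<le> ?B" if "t \<in> ?S" for t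
  proof -
    obtain G :: "nat graph" where G: "t = total_betti K G" "simple_graph G" "card (fst G) \<le> n"
      "\<not> has_induced_copy G (K5m m)" using \<open>t \<in> ?S\<close> by blast
    have "real t \<le> (4 / r3 ^ 5) ^ (m - 1) * r3 ^ card (fst G)"
      using total_betti_upper_bound[of G m K] G by (simp add: simple_graph_def)
    also have "\<dots> \<le> (4 / r3 ^ 5) ^ (m - 1) * r3 ^ n"
      using G(3) r3_ge by (intro mult_left_mono power_increasing) auto
    finally show ?thesis using B by simp
  qed
  \<comment> \<open>Natural numbers with a common bound form a finite set, so \<open>Max\<close> is
    a genuine maximum.\<close>
  have fin: "finite ?S"
  proof (rule finite_subset)
    show "?S \<subseteq> {..nat \<lfloor>?B\<rfloor>}" using ub by (force simp: le_nat_floor)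
  qed simp
  \<comment> \<open>The empty graph shows that the maximum is taken over a nonempty set;
    \<open>m \<ge> 1\<close> gives H a vertex that cannot be mapped into it.\<close>
  have "\<not> has_induced_copy (({}, {}) :: nat graph) (K5m m)"
  proof -
    have "(0, 0) \<in> fst (K5m m)" using assms by (simp add: K5m_def multipartite_vertices)
    then show ?thesis by (auto simp: has_induced_copy_def)
  qed
  then have "total_betti K (({}, {}) :: nat graph) \<in> ?S" by (force simp: simple_graph_def)
  then have "Max ?S \<in> ?S" using fin by (intro Max_in) auto
  then have bH: "real (b_H K (K5m m) n) \<le> ?B" using ub by (simp add: b_H_def)
  have "simple_graph G \<and> card (fst G) = n \<and> \<not> has_induced_copy G (K5m m) \<and>
      real (total_betti K G) = ?B \<and> real (b_H K (K5m m) n) = ?B"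
    if n: "n > 5 * (m - 1)" "4 dvd (n - 5 * (m - 1))" and G: "G = join_I5_I4 m q"
      and q: "q = (n - 5 * (m - 1)) div 4" for q G
  proof -
    have nq: "n = 5 * (m - 1) + 4 * q" using n q by auto
    have Bq: "?B = 4 ^ (m - 1) * 3 ^ q"
      using B bound_join_I5_I4[of m q] unfolding nq[symmetric] by (rule trans)
    have simple: "simple_graph G" unfolding G join_I5_I4_def by (rule simple_multipartite)
    then have finG: "finite (fst G)" by (simp add: simple_graph_def)
    have card: "card (fst G) = n" unfolding G nq by (rule card_join_I5_I4)
    have free: "\<not> has_induced_copy G (K5m m)" unfolding G by (rule join_I5_I4_free[OF assms])
    have lower: "?B \<le> real t" if "4 ^ (m - 1) * 3 ^ q \<le> int t" for t
    proof -
      have "real_of_int (4 ^ (m - 1) * 3 ^ q) \<le> real_of_int (int t)" using that by (rule of_int_le_iff[THEN iffD2])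
      then show ?thesis unfolding Bq by simp
    qed
    have "real (total_betti K G) \<le> ?B"
      using total_betti_upper_bound[OF finG free, of K] unfolding B card .
    moreover have "?B \<le> real (total_betti K G)"
      using euler_le_total_betti[OF finG, of K] unfolding G euler_join_I5_I4 by (rule lower)
    moreover have "?B \<le> real (b_H K (K5m m) n)"
    proof -
      \<comment> \<open>The relabelled join need not be shown to have the same Betti numbers: its
        Euler characteristic alone already forces the value \<open>?B\<close>.\<close>
      let ?G' = "map_graph prod_encode G"
      have inj: "inj prod_encode" by (rule inj_prod_encode)
      have simple': "simple_graph ?G'" by (rule simple_map_graph[OF inj simple])
      then have finG': "finite (fst ?G')" by (simp add: simple_graph_def)
      have "card (fst ?G') = n"
        using card card_image[OF inj_on_subset[OF inj]] by (simp add: map_graph_def)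
      moreover have "\<not> has_induced_copy ?G' (K5m m)"
        using free has_induced_copy_map_graph[OF inj] by blast
      ultimately have "total_betti K ?G' \<in> ?S" using simple' by blast
      then have "total_betti K ?G' \<le> b_H K (K5m m) n"
        unfolding b_H_def using fin by (intro Max_ge)
      moreover have "?B \<le> real (total_betti K ?G')"
        using euler_le_total_betti[OF finG', of K]
        unfolding euler_map_graph[OF inj] unfolding G euler_join_I5_I4 by (rule lower)
      ultimately show ?thesis by linarith
    qed
    ultimately show ?thesis using simple card free bH by linarith
  qed
  then show ?thesis using bH by (simp add: Let_def)
qed

end
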